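(* Fix $\delta\in(0,1/2)$. Consider a $\delta$-transient directed game on a weakly transitive graph $\Gamma$ with state space $Z$, a $\delta$-adapted family $\Pi$ for this game with transient speed function $h$, and i.i.d. payoffs $(G_z)_{z\in Z}$ supported on the interval $[0,1]$. Then there exist constants $v_\infty\in[0,1]$ and $K>0$ such that, for all $n\ge 1$, $t\ge 0$ and $z\in Z$, $$\mathbb{P}\left(|V_n(z)-v_\infty|\ge t+Kn^{-\delta}\right)\le 2\exp\left(-\frac{t^2n^2}{2h(n)}\right).$$ Consequently, for every initial state $z\in Z$, the sequence $(V_n(z))_{n\ge1}$ converges almost surely to $v_\infty$.
   Context: Directed game. A directed game consists of a locally finite directed graph $\Gamma$ with countably infinite vertex set $Z$ (the state space), an initial state $z_0\in Z$, and i.i.d. real random variables $(G_z)_{z\in Z}$ (payoffs). $\Gamma$ has uniformly bounded degrees, no directed cycles, and no vertex of out-degree $0$. The payoffs are sampled first and known to both players. A token starts at $z_0$; for each integer $i\ge0$, at stage $i+1$, the token being at $z$, Player 1 (if $i$ is even) or Player 2 (if $i$ is odd) moves it to an out-neighbor $z'$ of $z$, and Player 1 receives $G_{z'}$ from Player 2. A strategy of Player 1 (resp. Player 2) is a function $\sigma:\bigcup_{m\ge0}Z^{2m+1}\to Z$ (resp. $\tau:\bigcup_{m\ge0}Z^{2m+2}\to Z$) such that, for every $m\ge0$ and every $(z_0,\dots,z_{2m+1})\in Z^{2m+2}$, $\Gamma$ contains the edge from $z_{2m}$ to $\sigma(z_0,\dots,z_{2m})$ (resp. from $z_{2m+1}$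 to $\tau(z_0,\dots,z_{2m+1})$). $\Sigma$ and $\mathcal{T}$ denote the sets of strategies of Players 1 and 2. A pair $(\sigma,\tau)$ and the initial state $z_0$ determine the trajectory $z_{2i+1}=\sigma(z_0,\dots,z_{2i})$, $z_{2i+2}=\tau(z_0,\dots,z_{2i+1})$, $i\ge0$. The $n$-stage payoff is $\gamma_n^{z_0}(\sigma,\tau)=\frac1n\sum_{i=1}^nG_{z_i}$, and the $n$-value (a random variable) is $$V_n(z)=\max_{\sigma\in\Sigma}\min_{\tau\in\mathcal{T}}\gamma_n^z(\sigma,\tau)=\min_{\tau\in\mathcal{T}}\max_{\sigma\in\Sigma}\gamma_n^z(\sigma,\tau).$$ Weak transitivity. A descendant of $z$ is a vertex reachable from $z$ by a directed path. States $z,z'$ are equivalent if the subgraphs of $\Gamma$ induced by the descendants of $z$ and of $z'$, respectively, are isomorphic as directed graphs. $\Gamma$ is weakly transitive if there are a state $z^*$ and an integer $M$ such that, for each $z\in Z$, in the game with initial state $z$, each player has a strategy that, independently of the moves of the opponent, ensures that the token is placed at a state equivalent to $z^*$ after an even number $\ell\le M$ of stages. All graphs considered are assumed weakly transitive. $\delta$-transience. For $z\in Z$, an adapted partition is a partition $\Pi_z=(Z_i(z))_{i\ge0}$ of $Z$ (empty parts allowed) such that $Z_0(z)=\{z\}$ and, for all $(\sigma,\tau)\in\Sigma\times\mathcal{T}$ in the game starting at $z$ and all $i\ge1$, the token visits $Z_i(z)$ at most once. Set $Z_{[n]}(z)=\bigcup_{j=0}^nZ_j(z)$, and let $Z^{(n)}(z)$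 be the set of states reachable from $z$ in at most $n$ steps. For a family $\Pi=(\Pi_z)_{z\in Z}$ of adapted partitions, its transient speed function is $h(n)=\max_{z\in Z}\min\{k\in\mathbb{N}:Z^{(n)}(z)\subseteq Z_{[k]}(z)\}$, and $\psi(n,t)=\exp\left(-\frac{t^2n^2}{2h(n)}\right)\max_{z\in Z}|Z^{(2n)}(z)|$ for $n\in\mathbb{N}$, $t>0$. The game is $\delta$-transient if there exist a family $\Pi$ of adapted partitions and a sequence $(\varepsilon_n)_{n\ge1}$ of positive reals such that $\varepsilon_n+\psi(n,\varepsilon_n)=O(n^{-\delta})$; such a family $\Pi$ is called a $\delta$-adapted family. *)

theory Defs
  imports "HOL-Probability.Probability" "HOL-Library.Landau_Symbols"
    "Graph_Theory.Pair_Digraph" "Graph_Theory.Digraph_Isomorphism"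
begin

section \<open>Strategies, trajectories and values\<close>

text \<open>
  A history is the nonempty list of the states visited so far, oldest first. Player 1 moves at
  histories of odd length, Player 2 at histories of even length. The values of a strategy on
  other lists are irrelevant and left unconstrained.
\<close>

definition strategies1 :: "'a pair_pre_digraph \<Rightarrow> ('a list \<Rightarrow> 'a) set" where
  "strategies1 \<Gamma> = {\<sigma>. \<forall>xs. set xs \<subseteq> pverts \<Gamma> \<and> odd (length xs) \<longrightarrow> (last xs, \<sigma> xs) \<in> parcs \<Gamma>}"

definition strategies2 :: "'a pair_pre_digraph \<Rightarrow> ('a list \<Rightarrow> 'a) set" where
  "strategies2 \<Gamma> = {\<tau>. \<forall>xs. set xs \<subseteq> pverts \<Gamma> \<and> xs \<noteq> [] \<and> even (length xs) \<longrightarrow>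
     (last xs, \<tau> xs) \<in> parcs \<Gamma>}"

primrec history :: "('a list \<Rightarrow> 'a) \<Rightarrow> ('a list \<Rightarrow> 'a) \<Rightarrow> 'a \<Rightarrow> nat \<Rightarrow> 'a list" where
  "history \<sigma> \<tau> z 0 = [z]"
| "history \<sigma> \<tau> z (Suc i) = history \<sigma> \<tau> z i @
     [if even i then \<sigma> (history \<sigma> \<tau> z i) else \<tau> (history \<sigma> \<tau> z i)]"

definition trajectory :: "('a list \<Rightarrow> 'a) \<Rightarrow> ('a list \<Rightarrow> 'a) \<Rightarrow> 'a \<Rightarrow> nat \<Rightarrow> 'a" where
  "trajectory \<sigma> \<tau> z i = last (history \<sigma> \<tau> z i)"

definition stage_payoff ::
    "('a \<Rightarrow> real) \<Rightarrow> nat \<Rightarrow> 'a \<Rightarrow> ('a list \<Rightarrow> 'a) \<Rightarrow> ('a list \<Rightarrow> 'a) \<Rightarrow> real" where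
  "stage_payoff g n z \<sigma> \<tau> = 1 / real n * (\<Sum>i=1..n. g (trajectory \<sigma> \<tau> z i))"

text \<open>
  On a locally finite graph only finitely many states can be visited during the first \<open>n\<close> stages,
  so the maximum and the minima range over nonempty finite sets of reals even though the sets of
  strategies are infinite. Here \<open>g\<close> is a realisation of the payoffs.
\<close>

definition game_value :: "'a pair_pre_digraph \<Rightarrow> ('a \<Rightarrow> real) \<Rightarrow> nat \<Rightarrow> 'a \<Rightarrow> real" where
  "game_value \<Gamma> g n z = (MAX \<sigma>\<in>strategies1 \<Gamma>. MIN \<tau>\<in>strategies2 \<Gamma>. stage_payoff g n z \<sigma> \<tau>)"


section \<open>Directed games and weak transitivity\<close>

locale directed_game = prob_space M + pair_wf_digraph \<Gamma>
  for M :: "'w measure" and \<Gamma> :: "'a pair_pre_digraph" +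
  fixes z\<^sub>0 :: 'a and G :: "'a \<Rightarrow> 'w \<Rightarrow> real"
  assumes countable_states: "countable (pverts \<Gamma>)"
    and infinite_states: "infinite (pverts \<Gamma>)"
    and initial_state: "z\<^sub>0 \<in> pverts \<Gamma>"
    and locally_finite:
      "\<And>z. z \<in> pverts \<Gamma> \<Longrightarrow> finite (in_arcs \<Gamma> z) \<and> finite (out_arcs \<Gamma> z)"
    and bounded_degrees: "\<exists>D. \<forall>z\<in>pverts \<Gamma>. in_degree \<Gamma> z \<le> D \<and> out_degree \<Gamma> z \<le> D"
    and no_directed_cycle: "\<not> (\<exists>p. pre_digraph.cycle \<Gamma> p)"
    and out_degree_nonzero: "\<And>z. z \<in> pverts \<Gamma> \<Longrightarrow> out_degree \<Gamma> z \<noteq> 0"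
    and payoffs_indep: "prob_space.indep_vars M (\<lambda>_. borel) G (pverts \<Gamma>)"
    and payoffs_identically_distributed:
      "\<And>z z'. z \<in> pverts \<Gamma> \<Longrightarrow> z' \<in> pverts \<Gamma> \<Longrightarrow> distr M borel (G z) = distr M borel (G z')"

text \<open>Paths of length \<open>0\<close> are allowed: every state is a descendant of itself.\<close>

definition descendants :: "'a pair_pre_digraph \<Rightarrow> 'a \<Rightarrow> 'a set" where
  "descendants \<Gamma> z = {w. z \<rightarrow>\<^sup>*\<^bsub>\<Gamma>\<^esub> w}"

definition equivalent_states :: "'a pair_pre_digraph \<Rightarrow> 'a \<Rightarrow> 'a \<Rightarrow> bool" where
  "equivalent_states \<Gamma> z z' \<longleftrightarrow>
     digraph_iso (with_proj \<Gamma> \<restriction> descendants \<Gamma> z) (with_proj \<Gamma> \<restriction> descendants \<Gamma> z')"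

text \<open>
  The number of stages \<open>l\<close> may depend on the play; the state \<open>c\<close> and the bound \<open>L\<close> are common to
  both players and to all initial states.
\<close>

definition weakly_transitive :: "'a pair_pre_digraph \<Rightarrow> bool" where
  "weakly_transitive \<Gamma> \<longleftrightarrow> (\<exists>c\<in>pverts \<Gamma>. \<exists>L::nat. \<forall>z\<in>pverts \<Gamma>.
     (\<exists>\<sigma>\<in>strategies1 \<Gamma>. \<forall>\<tau>\<in>strategies2 \<Gamma>. \<exists>l\<le>L. even l \<and>
        equivalent_states \<Gamma> (trajectory \<sigma> \<tau> z l) c) \<and>
     (\<exists>\<tau>\<in>strategies2 \<Gamma>. \<forall>\<sigma>\<in>strategies1 \<Gamma>. \<exists>l\<le>L. even l \<and>
        equivalent_states \<Gamma> (trajectory \<sigma> \<tau> z l) c))"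


section \<open>Transience\<close>

definition adapted_partition :: "'a pair_pre_digraph \<Rightarrow> 'a \<Rightarrow> (nat \<Rightarrow> 'a set) \<Rightarrow> bool" where
  "adapted_partition \<Gamma> z Q \<longleftrightarrow>
     disjoint_family Q \<and> (\<Union>i. Q i) = pverts \<Gamma> \<and> Q 0 = {z} \<and>
     (\<forall>\<sigma>\<in>strategies1 \<Gamma>. \<forall>\<tau>\<in>strategies2 \<Gamma>. \<forall>i\<ge>1. \<forall>j k.
        trajectory \<sigma> \<tau> z j \<in> Q i \<and> trajectory \<sigma> \<tau> z k \<in> Q i \<longrightarrow> j = k)"

definition reachable_within :: "'a pair_pre_digraph \<Rightarrow> nat \<Rightarrow> 'a \<Rightarrow> 'a set" where
  "reachable_within \<Gamma> n z = {w. \<exists>k\<le>n. (z, w) \<in> parcs \<Gamma> ^^ k}"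

definition partition_depth ::
    "'a pair_pre_digraph \<Rightarrow> ('a \<Rightarrow> nat \<Rightarrow> 'a set) \<Rightarrow> nat \<Rightarrow> 'a \<Rightarrow> nat" where
  "partition_depth \<Gamma> P n z = (LEAST k. reachable_within \<Gamma> n z \<subseteq> (\<Union>j\<le>k. P z j))"

definition transient_speed ::
    "'a pair_pre_digraph \<Rightarrow> ('a \<Rightarrow> nat \<Rightarrow> 'a set) \<Rightarrow> nat \<Rightarrow> nat" where
  "transient_speed \<Gamma> P n = (MAX z\<in>pverts \<Gamma>. partition_depth \<Gamma> P n z)"

definition psi ::
    "'a pair_pre_digraph \<Rightarrow> ('a \<Rightarrow> nat \<Rightarrow> 'a set) \<Rightarrow> nat \<Rightarrow> real \<Rightarrow> real" where
  "psi \<Gamma> P n t = exp (- (t\<^sup>2 * (real n)\<^sup>2 / (2 * real (transient_speed \<Gamma> P n)))) *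
     real (MAX z\<in>pverts \<Gamma>. card (reachable_within \<Gamma> (2 * n) z))"

text \<open>
  The finiteness condition says that the maximum defining the transient speed function exists
  (\<open>Max\<close> of an infinite set is unspecified). Were that maximum infinite for some \<open>n\<close>, it would be
  infinite for all larger \<open>n\<close>, and the function \<open>psi\<close>, read with \<open>exp 0\<close> as first factor, would
  not tend to \<open>0\<close>.
\<close>

definition delta_adapted_family ::
    "'a pair_pre_digraph \<Rightarrow> real \<Rightarrow> ('a \<Rightarrow> nat \<Rightarrow> 'a set) \<Rightarrow> bool" where
  "delta_adapted_family \<Gamma> \<delta> P \<longleftrightarrow>
     (\<forall>z\<in>pverts \<Gamma>. adapted_partition \<Gamma> z (P z)) \<and>
     (\<forall>n. finite (partition_depth \<Gamma> P n ` pverts \<Gamma>)) \<and>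
     (\<exists>\<epsilon>::nat \<Rightarrow> real. (\<forall>n\<ge>1. \<epsilon> n > 0) \<and>
        (\<lambda>n. \<epsilon> n + psi \<Gamma> P n (\<epsilon> n)) \<in> O(\<lambda>n. real n powr (-\<delta>)))"

definition delta_transient :: "'a pair_pre_digraph \<Rightarrow> real \<Rightarrow> bool" where
  "delta_transient \<Gamma> \<delta> \<longleftrightarrow> (\<exists>P. delta_adapted_family \<Gamma> \<delta> P)"

end

theory Submission
  imports Defs
begin

text \<open>
  The total payoff of the \<open>n\<close>-stage game depends on the payoffs in at most \<open>h n + 1\<close> parts of an adapted
  partition, and changes by at most \<open>1\<close> when the payoffs in one part change, since a play visits the
  part at most once. A bounded difference inequality, with the parts as independent blocks, gives
  the concentration around the mean. By weak transitivity, after \<open>n\<close> stages either player can steer the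
  token to a state equivalent to a fixed state \<open>c\<close>. All such states reachable from \<open>z\<close> have the same mean
  value, and a union bound over them (this is what \<open>psi\<close> estimates) shows that their \<open>m\<close>-stage values are
  simultaneously close to it. So the mean of the total value is additive in the number of stages up
  to \<open>O(m powr (1 - \<delta>))\<close>, and an argument of Hyers and Ulam makes it linear up to the same error.
\<close>

section \<open>Concentration for functions of independent blocks\<close>

text \<open>The state to which the token is steered depends on the payoffs, so a deviation bound at
  one fixed state does not suffice; hence the union bound over all reachable states equivalent to
  \<open>c\<close>. Its radius explains the form of the additivity estimate: \<open>n\<close>
  stages, one more move to restore parity and at most \<open>L\<close> steering stages must fit into
  the \<open>2 * m\<close> steps counted by \<open>psi\<close>. So additivity is claimed only for
  \<open>n \<le> m\<close>, which is enough because the Hyers-Ulam argument uses only doubling and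
  \<open>n = 1\<close>.

  Total instead of average payoffs are used because they add up over stages. The maxima over
  strategies are first replaced by a backward recursion, \<open>total_value\<close>, so that
  monotonicity, measurability and dependence on finitely many payoffs all become inductions on the
  number of stages.

  The two error terms of the theorem have separate origins: \<open>K * n powr (-\<delta>)\<close> is
  the bias of the mean, the exponential is the fluctuation around it. For almost sure convergence
  the rate \<open>n powr (-\<delta>)\<close> is not summable as it stands, but at a fixed distance
  \<open>t\<close> the exponential is eventually smaller than any power of that rate.\<close>

lemma nn_exp_block_le:
  fixes f :: "'b \<Rightarrow> real"
  assumes N: "prob_space N" and f [measurable]: "f \<in> borel_measurable N"
    and osc: "\<And>x y. x \<in> space N \<Longrightarrow> y \<in> space N \<Longrightarrow> \<bar>f x - f y\<bar> \<le> c" and "s > 0"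
  shows "(\<integral>\<^sup>+x. ennreal (exp (s * (f x - integral\<^sup>L N f))) \<partial>N) \<le> ennreal (exp (s\<^sup>2 * c\<^sup>2 / 8))"
proof -
  interpret prob_space N by fact
  obtain x0 where x0: "x0 \<in> space N" using not_empty by blast
  \<comment> \<open>Only the oscillation is controlled. Taking the infimum as left endpoint gives an
    interval of length \<open>c\<close>, which is what Hoeffding's lemma asks for.\<close>
  define a where "a = (INF x\<in>space N. f x)"
  have bdd: "bdd_below (f ` space N)"
    using osc[OF x0] by (intro bdd_belowI2[of _ "f x0 - c"]) (force simp: abs_le_iff)
  have "f x \<in> {a..a + c}" if x: "x \<in> space N" for x
  proof -
    have "f x - c \<le> a"
      unfolding a_def using x0 osc[OF x] by (intro cINF_greatest) (force simp: abs_le_iff)+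
    moreover have "a \<le> f x" unfolding a_def using bdd x by (rule cINF_lower)
    ultimately show ?thesis by auto
  qed
  then interpret interval_bounded_random_variable N f a "a + c"
    by unfold_locales auto
  show ?thesis using Hoeffdings_lemma_nn_integral[OF \<open>s > 0\<close>] by simp
qed

text \<open>This is the method of bounded differences, with Fubini's theorem in place of conditional
  expectations. Integrating out the last block gives the function \<open>g\<close> of the earlier
  blocks. Averaging preserves the oscillation bounds, so the induction hypothesis applies to
  \<open>g\<close>, and for fixed earlier blocks the deviation of \<open>f\<close> from
  \<open>g\<close> is a one-block problem. This is why \<open>f\<close> is generalised in the
  induction.\<close>

lemma nn_exp_blocks_le:
  fixes M :: "'i \<Rightarrow> 'b measure" and B :: "nat \<Rightarrow> 'i set" and f :: "('i \<Rightarrow> 'b) \<Rightarrow> real"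
  assumes M: "\<And>i. prob_space (M i)" and fin: "\<And>j. finite (B j)" and disj: "disjoint_family B"
    and "s > 0"
    and "f \<in> borel_measurable (Pi\<^sub>M (\<Union>j<k. B j) M)"
    and "\<And>x. x \<in> space (Pi\<^sub>M (\<Union>j<k. B j) M) \<Longrightarrow> \<bar>f x\<bar> \<le> C"
    and "\<And>j x y. j < k \<Longrightarrow> x \<in> space (Pi\<^sub>M (\<Union>j<k. B j) M) \<Longrightarrow> y \<in> space (Pi\<^sub>M (\<Union>j<k. B j) M) \<Longrightarrow>
           (\<And>i. i \<notin> B j \<Longrightarrow> x i = y i) \<Longrightarrow> \<bar>f x - f y\<bar> \<le> c"
  shows "(\<integral>\<^sup>+x. ennreal (exp (s * (f x - integral\<^sup>L (Pi\<^sub>M (\<Union>j<k. B j) M) f))) \<partial>Pi\<^sub>M (\<Union>j<k. B j) M)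
           \<le> ennreal (exp (real k * (s\<^sup>2 * c\<^sup>2 / 8)))"
  using assms(5-)
proof (induction k arbitrary: f)
  \<comment> \<open>The empty product is a one-point space, on which \<open>f\<close> equals its
    mean.\<close>
  case 0
  show ?case
    by (simp add: PiM_empty nn_integral_count_space_finite lebesgue_integral_count_space_finite)
next
  case (Suc k)
  interpret product_sigma_finite M
    by (rule product_sigma_finite.intro) (rule prob_space_imp_sigma_finite[OF M])
  define I where "I = (\<Union>j<k. B j)"
  let ?J = "B k" and ?P = "Pi\<^sub>M I M" and ?Q = "Pi\<^sub>M (B k) M"
  have IJ: "I \<inter> ?J = {}"
  proof -
    have "B j \<inter> B k = {}" if "j < k" for j
      using disj that by (intro disjoint_family_onD[where I = UNIV]) auto
    then show ?thesis by (auto simp: I_def)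
  qed
  have [simp]: "finite I" "finite ?J" using fin by (auto simp: I_def)
  have U: "(\<Union>j<Suc k. B j) = I \<union> ?J" by (auto simp: I_def lessThan_Suc)
  note f [measurable] = Suc.prems(1)[unfolded U] and bd = Suc.prems(2)[unfolded U]
    and osc = Suc.prems(3)[unfolded U]
  interpret P: prob_space ?P by (rule prob_space_PiM) (rule M)
  interpret Q: prob_space ?Q by (rule prob_space_PiM) (rule M)
  interpret PQ: prob_space "Pi\<^sub>M (I \<union> ?J) M" by (rule prob_space_PiM) (rule M)
  have mrg [simp]: "merge I ?J (x, y) \<in> space (Pi\<^sub>M (I \<union> ?J) M)"
    if "x \<in> space ?P" "y \<in> space ?Q" for x y
    using that by (auto simp: space_PiM merge_def PiE_def Pi_def extensional_def)
  have mrg_eq: "merge I ?J (x, y) i = merge I ?J (x', y') i"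
    if "x i = x' i" "i \<notin> ?J \<or> y = y'" for x y x' y' i
    using that by (auto simp: merge_def)
  define g where "g x = (\<integral>y. f (merge I ?J (x, y)) \<partial>?Q)" for x
  have meas2 [measurable]: "(\<lambda>(x, y). f (merge I ?J (x, y))) \<in> borel_measurable (?P \<Otimes>\<^sub>M ?Q)"
    by measurable
  have g [measurable]: "g \<in> borel_measurable ?P"
    unfolding g_def by (rule Q.borel_measurable_lebesgue_integral) simp
  have sect [measurable]: "(\<lambda>y. f (merge I ?J (x, y))) \<in> borel_measurable ?Q" if "x \<in> space ?P" for x
    using measurable_compose[OF measurable_Pair1'[OF that] meas2] by simp
  have int: "integrable ?Q (\<lambda>y. f (merge I ?J (x, y)))" if "x \<in> space ?P" for x
    using that by (intro Q.integrable_const_bound[where B = C] AE_I2) (auto intro: bd)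
  have Ef: "integral\<^sup>L (Pi\<^sub>M (I \<union> ?J) M) f = integral\<^sup>L ?P g"
    unfolding g_def
    by (intro product_integral_fold IJ PQ.integrable_const_bound[where B = C] AE_I2) (auto intro: bd)
  have IH: "(\<integral>\<^sup>+x. ennreal (exp (s * (g x - integral\<^sup>L ?P g))) \<partial>?P)
      \<le> ennreal (exp (real k * (s\<^sup>2 * c\<^sup>2 / 8)))"
    unfolding I_def
  proof (rule Suc.IH, unfold I_def[symmetric])
    show "g \<in> borel_measurable ?P" by simp
    show "\<bar>g x\<bar> \<le> C" if "x \<in> space ?P" for x
    proof -
      have "\<bar>g x\<bar> \<le> (\<integral>y. \<bar>f (merge I ?J (x, y))\<bar> \<partial>?Q)"
        unfolding g_def by (rule integral_abs_bound)
      also have "\<dots> \<le> (\<integral>y. C \<partial>?Q)"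
        using int[OF that] that by (intro integral_mono) (auto intro: bd)
      finally show ?thesis by (simp add: Q.prob_space)
    qed
    show "\<bar>g x - g x'\<bar> \<le> c" if "j < k" "x \<in> space ?P" "x' \<in> space ?P" "\<And>i. i \<notin> B j \<Longrightarrow> x i = x' i" for j x x'
    proof -
      have ptw: "\<bar>f (merge I ?J (x, y)) - f (merge I ?J (x', y))\<bar> \<le> c" if "y \<in> space ?Q" for y
        using \<open>j < k\<close> \<open>x \<in> _\<close> \<open>x' \<in> _\<close> \<open>\<And>i. i \<notin> B j \<Longrightarrow> x i = x' i\<close> that
        by (intro osc[of j] mrg mrg_eq) auto
      have "\<bar>g x - g x'\<bar> = \<bar>\<integral>y. f (merge I ?J (x, y)) - f (merge I ?J (x', y)) \<partial>?Q\<bar>"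
        unfolding g_def using int that by simp
      also have "\<dots> \<le> (\<integral>y. \<bar>f (merge I ?J (x, y)) - f (merge I ?J (x', y))\<bar> \<partial>?Q)"
        by (rule integral_abs_bound)
      also have "\<dots> \<le> (\<integral>y. c \<partial>?Q)"
        using ptw int that by (intro integral_mono) auto
      finally show ?thesis by (simp add: Q.prob_space)
    qed
  qed
  have inner: "(\<integral>\<^sup>+y. ennreal (exp (s * (f (merge I ?J (x, y)) - g x))) \<partial>?Q) \<le> ennreal (exp (s\<^sup>2 * c\<^sup>2 / 8))"
    if x: "x \<in> space ?P" for x
    unfolding g_def using x \<open>s > 0\<close>
    by (intro nn_exp_block_le Q.prob_space_axioms osc[of k] mrg mrg_eq sect) auto
  let ?m = "integral\<^sup>L ?P g"
  have "(\<integral>\<^sup>+x. ennreal (exp (s * (f x - ?m))) \<partial>Pi\<^sub>M (I \<union> ?J) M)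
      = (\<integral>\<^sup>+x. (\<integral>\<^sup>+y. ennreal (exp (s * (f (merge I ?J (x, y)) - ?m))) \<partial>?Q) \<partial>?P)"
    by (intro product_nn_integral_fold IJ) auto
  \<comment> \<open>Splitting \<open>f - ?m\<close> into \<open>(f - g) + (g - ?m)\<close> makes the
    exponential a product whose second factor does not involve the last block.\<close>
  also have "\<dots> = (\<integral>\<^sup>+x. ennreal (exp (s * (g x - ?m))) *
      (\<integral>\<^sup>+y. ennreal (exp (s * (f (merge I ?J (x, y)) - g x))) \<partial>?Q) \<partial>?P)"
    by (intro nn_integral_cong, subst nn_integral_cmult[symmetric])
       (auto simp: ennreal_mult[symmetric] exp_add[symmetric] algebra_simps intro!: nn_integral_cong)
  also have "\<dots> \<le> (\<integral>\<^sup>+x. ennreal (exp (s * (g x - ?m))) * ennreal (exp (s\<^sup>2 * c\<^sup>2 / 8)) \<partial>?P)"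
    by (intro nn_integral_mono mult_left_mono inner) auto
  also have "\<dots> = (\<integral>\<^sup>+x. ennreal (exp (s * (g x - ?m))) \<partial>?P) * ennreal (exp (s\<^sup>2 * c\<^sup>2 / 8))"
    by (rule nn_integral_multc) simp
  also have "\<dots> \<le> ennreal (exp (real k * (s\<^sup>2 * c\<^sup>2 / 8))) * ennreal (exp (s\<^sup>2 * c\<^sup>2 / 8))"
    by (intro mult_right_mono IH) auto
  also have "\<dots> = ennreal (exp (real (Suc k) * (s\<^sup>2 * c\<^sup>2 / 8)))"
    by (simp add: ennreal_mult[symmetric] exp_add[symmetric] algebra_simps)
  finally show ?case unfolding U Ef .
qed

text \<open>By independence the joint law of the \<open>X i\<close> is a product measure, so
  Chernoff's bound reduces to the exponential moment above. The exponent parameter has to be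
  positive, which is why \<open>t = 0\<close>, where the claim is that a probability is at most 1,
  is treated apart.\<close>

lemma (in prob_space) block_concentration_ge:
  fixes X :: "'i \<Rightarrow> 'a \<Rightarrow> real" and f :: "('i \<Rightarrow> real) \<Rightarrow> real" and B :: "nat \<Rightarrow> 'i set"
  assumes indep: "indep_vars (\<lambda>_. borel) X I" and I: "I = (\<Union>j<k. B j)" "I \<noteq> {}"
    and fin: "\<And>j. finite (B j)" and disj: "disjoint_family B"
    and f: "f \<in> borel_measurable (Pi\<^sub>M I (\<lambda>_. borel))"
    and bd: "\<And>x. \<bar>f x\<bar> \<le> C"
    and osc: "\<And>j x y. j < k \<Longrightarrow> (\<And>i. i \<notin> B j \<Longrightarrow> x i = y i) \<Longrightarrow> \<bar>f x - f y\<bar> \<le> c"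
    and "0 < c" "0 \<le> t"
  shows "prob {\<omega> \<in> space M. t \<le> f (\<lambda>i\<in>I. X i \<omega>) - expectation (\<lambda>\<omega>. f (\<lambda>i\<in>I. X i \<omega>))}
           \<le> exp (- (2 * t\<^sup>2 / (real k * c\<^sup>2)))"
proof (cases "t = 0")
  case False
  with \<open>0 \<le> t\<close> have "0 < t" by simp
  have "0 < k" using I by (cases k) auto
  \<comment> \<open>The product estimate wants a probability measure at every index, while nothing
    is known about \<open>X i\<close> outside \<open>I\<close>; constants fill the gap.\<close>
  define Y where "Y i = (if i \<in> I then X i else (\<lambda>_. 0))" for i
  have X: "random_variable borel (X i)" if "i \<in> I" for i
    using indep that by (auto simp: indep_vars_def)
  have Y: "random_variable borel (Y i)" for i using X by (auto simp: Y_def)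
  define N where "N i = distr M borel (Y i)" for i
  have N: "prob_space (N i)" for i unfolding N_def by (rule prob_space_distr) (rule Y)
  have [simp]: "sets (N i) = sets borel" for i by (simp add: N_def)
  let ?R = "\<lambda>\<omega>. \<lambda>i\<in>I. X i \<omega>"
  have R [measurable]: "?R \<in> measurable M (Pi\<^sub>M I (\<lambda>_. borel))"
    using X by (intro measurable_restrict) auto
  have law: "distr M (Pi\<^sub>M I (\<lambda>_. borel)) ?R = Pi\<^sub>M I N"
  proof -
    have "distr M (Pi\<^sub>M I (\<lambda>_. borel)) ?R = Pi\<^sub>M I (\<lambda>i. distr M borel (X i))"
      using indep indep_vars_iff_distr_eq_PiM'[OF I(2) X] by simp
    also have "\<dots> = Pi\<^sub>M I N" by (intro PiM_cong) (auto simp: N_def Y_def)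
    finally show ?thesis .
  qed
  have sets_eq: "sets (Pi\<^sub>M I N) = sets (Pi\<^sub>M I (\<lambda>_. borel))"
    by (intro sets_PiM_cong) auto
  have fN: "f \<in> borel_measurable (Pi\<^sub>M I N)"
    using f by (simp cong: measurable_cong_sets add: sets_eq)
  note [measurable] = f
  define m where "m = expectation (\<lambda>\<omega>. f (?R \<omega>))"
  have m: "m = integral\<^sup>L (Pi\<^sub>M I N) f"
    unfolding m_def law[symmetric] by (subst integral_distr) auto
  \<comment> \<open>This \<open>s\<close> minimises
    \<open>- s * t + k * s\<^sup>2 * c\<^sup>2 / 8\<close>.\<close>
  define s where "s = 4 * t / (real k * c\<^sup>2)"
  have "s > 0" using \<open>0 < t\<close> \<open>0 < k\<close> \<open>0 < c\<close> by (simp add: s_def)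
  have "ennreal (prob {\<omega> \<in> space M. t \<le> f (?R \<omega>) - m}) \<le>
      ennreal (exp (- s * t)) * (\<integral>\<^sup>+\<omega>\<in>space M. ennreal (exp (s * (f (?R \<omega>) - m))) \<partial>M)"
    unfolding emeasure_eq_measure[symmetric]
    by (rule Chernoff_ineq_nn_integral_ge) (use \<open>s > 0\<close> in auto)
  also have "(\<integral>\<^sup>+\<omega>\<in>space M. ennreal (exp (s * (f (?R \<omega>) - m))) \<partial>M)
      = (\<integral>\<^sup>+x. ennreal (exp (s * (f x - m))) \<partial>Pi\<^sub>M I N)"
    unfolding law[symmetric]
    by (subst nn_integral_distr) (auto intro!: nn_integral_cong simp: indicator_def)
  also have "ennreal (exp (- s * t)) * \<dots> \<le>
      ennreal (exp (- s * t)) * ennreal (exp (real k * (s\<^sup>2 * c\<^sup>2 / 8)))"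
    unfolding m I(1)
    by (intro mult_left_mono nn_exp_blocks_le) (use N fin disj \<open>s > 0\<close> fN bd osc I(1) in auto)
  also have "ennreal (exp (- s * t)) * ennreal (exp (real k * (s\<^sup>2 * c\<^sup>2 / 8)))
      = ennreal (exp (- s * t + real k * (s\<^sup>2 * c\<^sup>2 / 8)))"
    by (simp add: ennreal_mult[symmetric] exp_add[symmetric])
  also have "- s * t + real k * (s\<^sup>2 * c\<^sup>2 / 8) = - (2 * t\<^sup>2 / (real k * c\<^sup>2))"
    using \<open>0 < k\<close> \<open>0 < c\<close> by (simp add: s_def field_simps power2_eq_square)
  finally show ?thesis
    unfolding m_def by (subst (asm) ennreal_le_iff) auto
qed simp

lemma (in prob_space) block_concentration:
  fixes X :: "'i \<Rightarrow> 'a \<Rightarrow> real" and f :: "('i \<Rightarrow> real) \<Rightarrow> real" and B :: "nat \<Rightarrow> 'i set"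
  assumes indep: "indep_vars (\<lambda>_. borel) X I" and I: "I = (\<Union>j<k. B j)" "I \<noteq> {}"
    and fin: "\<And>j. finite (B j)" and disj: "disjoint_family B"
    and f: "f \<in> borel_measurable (Pi\<^sub>M I (\<lambda>_. borel))"
    and bd: "\<And>x. \<bar>f x\<bar> \<le> C"
    and osc: "\<And>j x y. j < k \<Longrightarrow> (\<And>i. i \<notin> B j \<Longrightarrow> x i = y i) \<Longrightarrow> \<bar>f x - f y\<bar> \<le> c"
    and "0 < c" "0 \<le> t"
  shows "prob {\<omega> \<in> space M. t \<le> \<bar>f (\<lambda>i\<in>I. X i \<omega>) - expectation (\<lambda>\<omega>. f (\<lambda>i\<in>I. X i \<omega>))\<bar>}
           \<le> 2 * exp (- (2 * t\<^sup>2 / (real k * c\<^sup>2)))"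
proof -
  let ?D = "\<lambda>\<omega>. f (\<lambda>i\<in>I. X i \<omega>) - expectation (\<lambda>\<omega>. f (\<lambda>i\<in>I. X i \<omega>))"
  have X: "random_variable borel (X i)" if "i \<in> I" for i
    using indep that by (auto simp: indep_vars_def)
  have R [measurable]: "(\<lambda>\<omega>. \<lambda>i\<in>I. X i \<omega>) \<in> measurable M (Pi\<^sub>M I (\<lambda>_. borel))"
    using X by (intro measurable_restrict) auto
  note [measurable] = f
  have "prob {\<omega> \<in> space M. t \<le> ?D \<omega>} \<le> exp (- (2 * t\<^sup>2 / (real k * c\<^sup>2)))"
    by (rule block_concentration_ge) fact+
  moreover have "prob {\<omega> \<in> space M. t \<le> - ?D \<omega>} \<le> exp (- (2 * t\<^sup>2 / (real k * c\<^sup>2)))"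
  proof -
    have "prob {\<omega> \<in> space M. t \<le> - f (\<lambda>i\<in>I. X i \<omega>) - expectation (\<lambda>\<omega>. - f (\<lambda>i\<in>I. X i \<omega>))}
        \<le> exp (- (2 * t\<^sup>2 / (real k * c\<^sup>2)))"
    proof (rule block_concentration_ge[OF indep I fin disj])
      show "\<bar>- f x - - f y\<bar> \<le> c" if "j < k" "\<And>i. i \<notin> B j \<Longrightarrow> x i = y i" for j x y
        using osc[of j x y] that by (fastforce simp: abs_minus_commute)
      show "\<bar>- f x\<bar> \<le> C" for x using bd[of x] by simp
    qed (use f \<open>0 < c\<close> \<open>0 \<le> t\<close> in auto)
    then show ?thesis by (simp add: algebra_simps)
  qed
  moreover have "prob {\<omega> \<in> space M. t \<le> \<bar>?D \<omega>\<bar>}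
      \<le> prob ({\<omega> \<in> space M. t \<le> ?D \<omega>} \<union> {\<omega> \<in> space M. t \<le> - ?D \<omega>})"
    by (intro finite_measure_mono) (auto simp: abs_if split: if_splits)
  moreover have "\<dots> \<le> prob {\<omega> \<in> space M. t \<le> ?D \<omega>} + prob {\<omega> \<in> space M. t \<le> - ?D \<omega>}"
    by (rule measure_Un_le) auto
  ultimately show ?thesis by linarith
qed

section \<open>Transport of i.i.d. families along injections\<close>

lemma (in prob_space) distr_indep_vars_reindex:
  assumes indep: "indep_vars (\<lambda>_. borel) X I" and f: "inj_on f J" "f \<in> J \<rightarrow> I" and "J \<noteq> {}"
  shows "distr M (Pi\<^sub>M J (\<lambda>_. borel)) (\<lambda>\<omega>. \<lambda>j\<in>J. X (f j) \<omega>) = Pi\<^sub>M J (\<lambda>j. distr M borel (X (f j)))"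
proof -
  have X: "random_variable borel (X i)" if "i \<in> I" for i
    using indep that by (auto simp: indep_vars_def)
  have "I \<noteq> {}" using f(2) \<open>J \<noteq> {}\<close> by auto
  have R [measurable]: "(\<lambda>\<omega>. \<lambda>i\<in>I. X i \<omega>) \<in> measurable M (Pi\<^sub>M I (\<lambda>_. borel))"
    using X by (intro measurable_restrict) auto
  have S [measurable]: "(\<lambda>x. \<lambda>j\<in>J. x (f j)) \<in> measurable (Pi\<^sub>M I (\<lambda>_. borel)) (Pi\<^sub>M J (\<lambda>_. borel))"
    using f(2) by (intro measurable_restrict measurable_component_singleton) auto
  have "distr M (Pi\<^sub>M J (\<lambda>_. borel)) (\<lambda>\<omega>. \<lambda>j\<in>J. X (f j) \<omega>)
      = distr (distr M (Pi\<^sub>M I (\<lambda>_. borel)) (\<lambda>\<omega>. \<lambda>i\<in>I. X i \<omega>)) (Pi\<^sub>M J (\<lambda>_. borel)) (\<lambda>x. \<lambda>j\<in>J. x (f j))"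
    using f(2) by (subst distr_distr) (auto simp: comp_def Pi_iff intro!: distr_cong)
  also have "\<dots> = distr (Pi\<^sub>M I (\<lambda>i. distr M borel (X i))) (Pi\<^sub>M J (\<lambda>_. borel)) (\<lambda>x. \<lambda>j\<in>J. x (f j))"
    using indep indep_vars_iff_distr_eq_PiM'[OF \<open>I \<noteq> {}\<close> X] by simp
  also have "\<dots> = distr (Pi\<^sub>M I (\<lambda>i. distr M borel (X i))) (Pi\<^sub>M J (\<lambda>j. distr M borel (X (f j)))) (\<lambda>x. \<lambda>j\<in>J. x (f j))"
    by (intro distr_cong sets_PiM_cong) auto
  also have "\<dots> = Pi\<^sub>M J (\<lambda>j. distr M borel (X (f j)))"
    using f X by (intro distr_PiM_reindex) (auto intro: prob_space_distr)
  finally show ?thesis .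
qed

text \<open>An injective change of indices keeps independence, and identical distribution makes both
  joint laws the same product. It is meant for \<open>f\<close> an isomorphism between the
  descendants of two equivalent states.\<close>

lemma (in prob_space) expectation_iid_reindex:
  fixes F :: "('i \<Rightarrow> real) \<Rightarrow> real"
  assumes indep: "indep_vars (\<lambda>_. borel) X I"
    and ident: "\<And>i j. i \<in> I \<Longrightarrow> j \<in> I \<Longrightarrow> distr M borel (X i) = distr M borel (X j)"
    and f: "inj_on f J" "f \<in> J \<rightarrow> I" and J: "J \<subseteq> I" "J \<noteq> {}"
    and F [measurable]: "F \<in> borel_measurable (Pi\<^sub>M J (\<lambda>_. borel))"
  shows "expectation (\<lambda>\<omega>. F (\<lambda>j\<in>J. X (f j) \<omega>)) = expectation (\<lambda>\<omega>. F (\<lambda>j\<in>J. X j \<omega>))"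
proof -
  have X: "random_variable borel (X i)" if "i \<in> I" for i
    using indep that by (auto simp: indep_vars_def)
  have [measurable]: "(\<lambda>\<omega>. \<lambda>j\<in>J. X (f j) \<omega>) \<in> measurable M (Pi\<^sub>M J (\<lambda>_. borel))"
    "(\<lambda>\<omega>. \<lambda>j\<in>J. X j \<omega>) \<in> measurable M (Pi\<^sub>M J (\<lambda>_. borel))"
    using X f(2) J(1) by (auto intro!: measurable_restrict)
  have "distr M (Pi\<^sub>M J (\<lambda>_. borel)) (\<lambda>\<omega>. \<lambda>j\<in>J. X (f j) \<omega>) = Pi\<^sub>M J (\<lambda>j. distr M borel (X (f j)))"
    using distr_indep_vars_reindex[OF indep f J(2)] .
  also have "\<dots> = Pi\<^sub>M J (\<lambda>j. distr M borel (X j))"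
    using f(2) J(1) by (intro PiM_cong ident) auto
  also have "\<dots> = distr M (Pi\<^sub>M J (\<lambda>_. borel)) (\<lambda>\<omega>. \<lambda>j\<in>J. X j \<omega>)"
    using distr_indep_vars_reindex[OF indep, of id J] J by (simp add: Pi_iff subset_iff)
  finally have "(\<integral>x. F x \<partial>distr M (Pi\<^sub>M J (\<lambda>_. borel)) (\<lambda>\<omega>. \<lambda>j\<in>J. X (f j) \<omega>))
      = (\<integral>x. F x \<partial>distr M (Pi\<^sub>M J (\<lambda>_. borel)) (\<lambda>\<omega>. \<lambda>j\<in>J. X j \<omega>))"
    by simp
  then show ?thesis by (simp add: integral_distr)
qed

section \<open>Almost additive sequences and rates\<close>

text \<open>The rescaled values \<open>a (2 ^ k * n) / 2 ^ k\<close> have increments bounded by a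
  geometric sequence with ratio \<open>2 powr (-\<delta>) < 1\<close>, so they converge to some
  \<open>l n\<close>, and summing the series bounds the distance from \<open>a n\<close>. The same
  rescaling makes the additivity defect vanish in the limit, so \<open>l\<close> satisfies the
  additive equation exactly and induction with \<open>n = 1\<close> gives
  \<open>l n = n * l 1\<close>.\<close>

lemma almost_additive_imp_almost_linear:
  fixes a :: "nat \<Rightarrow> real"
  assumes add: "\<And>n m. 1 \<le> m \<Longrightarrow> n \<le> m \<Longrightarrow> \<bar>a (n + m) - a n - a m\<bar> \<le> C * real m powr (1 - \<delta>)"
    and "0 < \<delta>"
  shows "\<exists>v. \<exists>K. \<forall>n\<ge>1. \<bar>a n - real n * v\<bar> \<le> K * real n powr (1 - \<delta>)"
proof -
  define r where "r = (2::real) powr (-\<delta>)"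
  have r: "0 < r" "r < 1" using \<open>0 < \<delta>\<close> by (auto simp: r_def powr_less_one)
  have pw: "real (2 ^ k * n) powr (1 - \<delta>) / 2 ^ k = real n powr (1 - \<delta>) * r ^ k" for k n
  proof -
    have "r ^ k = (2 ^ k) powr (-\<delta>)"
      by (simp add: r_def powr_powr powr_realpow[symmetric] mult.commute flip: powr_realpow)
    then have "(2 ^ k) powr (1 - \<delta>) = 2 ^ k * r ^ k"
      by (simp add: powr_diff powr_minus divide_inverse)
    then show ?thesis by (simp add: powr_mult)
  qed
  have "0 \<le> C" using add[of 1 0] by (auto dest!: order_trans[OF abs_ge_zero])
  define b where "b n k = a (2 ^ k * n) / 2 ^ k" for n k
  have step: "\<bar>b n (Suc k) - b n k\<bar> \<le> C / 2 * real n powr (1 - \<delta>) * r ^ k" if "1 \<le> n" for n k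
  proof -
    have "\<bar>a (2 ^ k * n + 2 ^ k * n) - a (2 ^ k * n) - a (2 ^ k * n)\<bar> \<le> C * real (2 ^ k * n) powr (1 - \<delta>)"
      using that by (intro add) auto
    also have "2 ^ k * n + 2 ^ k * n = 2 ^ Suc k * n" by simp
    also have "a (2 ^ Suc k * n) - a (2 ^ k * n) - a (2 ^ k * n) = a (2 ^ Suc k * n) - 2 * a (2 ^ k * n)"
      by (simp only: algebra_simps mult_2)
    finally have "\<bar>a (2 ^ Suc k * n) - 2 * a (2 ^ k * n)\<bar> / 2 ^ Suc k \<le> C * real (2 ^ k * n) powr (1 - \<delta>) / 2 ^ Suc k"
      by (rule divide_right_mono) simp
    moreover have "b n (Suc k) - b n k = (a (2 ^ Suc k * n) - 2 * a (2 ^ k * n)) / 2 ^ Suc k"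
      by (simp add: b_def field_simps)
    ultimately have "\<bar>b n (Suc k) - b n k\<bar> \<le> C / 2 * (real (2 ^ k * n) powr (1 - \<delta>) / 2 ^ k)"
      by (simp add: abs_divide)
    then show ?thesis unfolding pw by simp
  qed
  have sm: "summable (\<lambda>k. C / 2 * real n powr (1 - \<delta>) * r ^ k)" for n
    using r by (intro summable_mult summable_geometric) auto
  have sb: "summable (\<lambda>k. b n (Suc k) - b n k)" if "1 \<le> n" for n
    by (rule summable_comparison_test[OF _ sm[of n]]) (use step[OF that] in auto)
  define l where "l n = b n 0 + (\<Sum>k. b n (Suc k) - b n k)" for n
  have bl: "b n \<longlonglongrightarrow> l n" if "1 \<le> n" for n
  proof -
    have "(\<lambda>k. \<Sum>i<k. b n (Suc i) - b n i) \<longlonglongrightarrow> (\<Sum>k. b n (Suc k) - b n k)"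
      using sb[OF that] by (rule summable_LIMSEQ)
    then have "(\<lambda>k. b n 0 + (b n k - b n 0)) \<longlonglongrightarrow> l n"
      unfolding l_def sum_lessThan_telescope by (intro tendsto_intros)
    then show ?thesis by simp
  qed
  have al: "\<bar>a n - l n\<bar> \<le> C / 2 / (1 - r) * real n powr (1 - \<delta>)" if "1 \<le> n" for n
  proof -
    have "a n - l n = - (\<Sum>k. b n (Suc k) - b n k)" by (simp add: l_def b_def)
    then have "\<bar>a n - l n\<bar> = \<bar>\<Sum>k. b n (Suc k) - b n k\<bar>" by simp
    also have "\<dots> \<le> (\<Sum>k. C / 2 * real n powr (1 - \<delta>) * r ^ k)"
      using norm_suminf_le[OF _ sm[of n], of "\<lambda>k. b n (Suc k) - b n k"] step[OF that] by simp
    also have "\<dots> = C / 2 * real n powr (1 - \<delta>) * (1 / (1 - r))"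
      using r by (subst suminf_mult) (auto simp: suminf_geometric)
    finally show ?thesis by (simp add: field_simps)
  qed
  have ladd: "l (n + m) = l n + l m" if "1 \<le> n" "n \<le> m" for n m
  proof -
    have "(\<lambda>k. b (n + m) k - b n k - b m k) \<longlonglongrightarrow> l (n + m) - l n - l m"
      using that by (intro tendsto_intros bl) auto
    moreover have "(\<lambda>k. b (n + m) k - b n k - b m k) \<longlonglongrightarrow> 0"
    proof (rule Lim_null_comparison)
      show "eventually (\<lambda>k. norm (b (n + m) k - b n k - b m k) \<le> C * real m powr (1 - \<delta>) * r ^ k) sequentially"
      proof (intro always_eventually allI)
        fix k
        have "\<bar>a (2 ^ k * n + 2 ^ k * m) - a (2 ^ k * n) - a (2 ^ k * m)\<bar> / 2 ^ k
            \<le> C * real (2 ^ k * m) powr (1 - \<delta>) / 2 ^ k"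
          using that by (intro divide_right_mono add) auto
        also have "\<dots> = C * (real (2 ^ k * m) powr (1 - \<delta>) / 2 ^ k)" by simp
        also have "\<dots> = C * real m powr (1 - \<delta>) * r ^ k" unfolding pw by simp
        finally show "norm (b (n + m) k - b n k - b m k) \<le> C * real m powr (1 - \<delta>) * r ^ k"
          by (simp add: b_def abs_divide diff_divide_distrib[symmetric] distrib_left)
      qed
      show "(\<lambda>k. C * real m powr (1 - \<delta>) * r ^ k) \<longlonglongrightarrow> 0"
        using r by (intro tendsto_mult_right_zero LIMSEQ_power_zero) auto
    qed
    ultimately have "l (n + m) - l n - l m = 0" by (rule LIMSEQ_unique)
    then show ?thesis by simp
  qed
  have "l n = real n * l 1" if "1 \<le> n" for n
    using that
  proof (induction n rule: nat_induct_at_least)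
    case (Suc n)
    then show ?case using ladd[of 1 n] by (simp add: algebra_simps)
  qed simp
  then show ?thesis using al by metis
qed

section \<open>Decay rates and summability\<close>

lemma powr_decay:
  assumes "0 < \<delta>"
  shows "(\<lambda>n. C * real n powr (-\<delta>)) \<longlonglongrightarrow> 0"
  using assms by (intro tendsto_mult_right_zero tendsto_neg_powr filterlim_real_sequentially) simp

lemma bigo_sum_bounds:
  assumes "\<And>n. 0 \<le> q n" "\<And>n. 1 \<le> n \<Longrightarrow> 0 < \<epsilon> n"
    and "(\<lambda>n. \<epsilon> n + q n) \<in> O(\<lambda>n. real n powr (-\<delta>))"
  shows "\<exists>C>0. \<exists>N. \<forall>n\<ge>N. \<epsilon> n \<le> C * real n powr (-\<delta>) \<and> q n \<le> C * real n powr (-\<delta>)"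
proof -
  obtain C where C: "C > 0" "eventually (\<lambda>n. norm (\<epsilon> n + q n) \<le> C * norm (real n powr (-\<delta>))) sequentially"
    using assms(3) by (elim landau_o.bigE)
  then obtain N where N: "\<And>n. n \<ge> N \<Longrightarrow> \<bar>\<epsilon> n + q n\<bar> \<le> C * real n powr (-\<delta>)"
    by (auto simp: eventually_sequentially)
  have "\<epsilon> n \<le> C * real n powr (-\<delta>) \<and> q n \<le> C * real n powr (-\<delta>)" if "n \<ge> max N 1" for n
    using N[of n] assms(1)[of n] assms(2)[of n] that by auto
  then show ?thesis using C(1) by blast
qed

text \<open>Passing from \<open>\<epsilon> n\<close> to a fixed \<open>t\<close> raises the \<open>n\<close>-th term to a power that tends to infinity.\<close>

lemma summable_exp_rate:
  fixes X \<epsilon> :: "nat \<Rightarrow> real"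
  assumes X: "\<And>n. 0 \<le> X n" and "0 < \<delta>" "0 < t" and \<epsilon>: "\<And>n. 1 \<le> n \<Longrightarrow> 0 < \<epsilon> n"
    and "(\<lambda>n. \<epsilon> n + exp (- ((\<epsilon> n)\<^sup>2 * X n))) \<in> O(\<lambda>n. real n powr (-\<delta>))"
  shows "summable (\<lambda>n. exp (- (t\<^sup>2 * X n)))"
proof -
  have "\<exists>C>0. \<exists>N. \<forall>n\<ge>N. \<epsilon> n \<le> C * real n powr (-\<delta>) \<and>
      exp (- ((\<epsilon> n)\<^sup>2 * X n)) \<le> C * real n powr (-\<delta>)"
    by (rule bigo_sum_bounds) (use assms in auto)
  then obtain C N where C: "C > 0" and N: "\<And>n. n \<ge> N \<Longrightarrow> \<epsilon> n \<le> C * real n powr (-\<delta>)"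
    "\<And>n. n \<ge> N \<Longrightarrow> exp (- ((\<epsilon> n)\<^sup>2 * X n)) \<le> C * real n powr (-\<delta>)"
    by blast
  \<comment> \<open>With this \<open>k\<close> the \<open>k\<close>-th power of
    \<open>C * n powr (-\<delta>)\<close> is at most a constant times \<open>n powr (-2)\<close>,
    which is summable. Because \<open>\<epsilon> n\<close> tends to 0, eventually
    \<open>k * (\<epsilon> n)\<^sup>2 \<le> t\<^sup>2\<close>, so the exponential at
    \<open>t\<close> is below the \<open>k\<close>-th power of the one at
    \<open>\<epsilon> n\<close>.\<close>
  define k where "k = nat \<lceil>2 / \<delta>\<rceil>"
  have k: "2 \<le> \<delta> * real k"
  proof -
    have "2 / \<delta> \<le> real k" unfolding k_def by linarith
    then show ?thesis using \<open>0 < \<delta>\<close> by (simp add: field_simps)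
  qed
  have "(\<lambda>n. real k * (C * real n powr (-\<delta>))\<^sup>2) \<longlonglongrightarrow> real k * 0\<^sup>2"
    by (intro tendsto_mult_left tendsto_power powr_decay \<open>0 < \<delta>\<close>)
  then have lim: "(\<lambda>n. real k * (C * real n powr (-\<delta>))\<^sup>2) \<longlonglongrightarrow> 0" by simp
  have "0 < t\<^sup>2" using \<open>0 < t\<close> by simp
  from order_tendstoD(2)[OF lim this]
  obtain N' where N': "\<And>n. n \<ge> N' \<Longrightarrow> real k * (C * real n powr (-\<delta>))\<^sup>2 < t\<^sup>2"
    by (auto simp: eventually_sequentially)
  have bound: "norm (exp (- (t\<^sup>2 * X n))) \<le> C ^ k * real n powr (-2)" if "n \<ge> max 1 (max N N')" for n
  proof -
    have n: "n \<ge> N" "n \<ge> N'" "n \<ge> 1" using that by auto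
    have "(\<epsilon> n)\<^sup>2 \<le> (C * real n powr (-\<delta>))\<^sup>2"
      using N(1)[OF n(1)] \<epsilon>[OF n(3)] by (intro power_mono) auto
    then have "real k * (\<epsilon> n)\<^sup>2 \<le> real k * (C * real n powr (-\<delta>))\<^sup>2" by (intro mult_left_mono) auto
    also have "\<dots> \<le> t\<^sup>2" using N'[OF n(2)] by simp
    finally have "real k * (\<epsilon> n)\<^sup>2 * X n \<le> t\<^sup>2 * X n" using X by (intro mult_right_mono) auto
    then have "exp (- (t\<^sup>2 * X n)) \<le> exp (real k * - ((\<epsilon> n)\<^sup>2 * X n))" by (simp add: mult.assoc)
    also have "\<dots> = exp (- ((\<epsilon> n)\<^sup>2 * X n)) ^ k" by (rule exp_of_nat_mult)
    also have "\<dots> \<le> (C * real n powr (-\<delta>)) ^ k" using N(2)[OF n(1)] by (intro power_mono) auto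
    also have "\<dots> = C ^ k * real n powr (- (\<delta> * real k))"
      using n(3) by (simp add: power_mult_distrib powr_powr flip: powr_realpow)
    also have "\<dots> \<le> C ^ k * real n powr (-2)"
      using k n(3) C by (intro mult_left_mono powr_mono) auto
    finally show ?thesis by simp
  qed
  have "summable (\<lambda>n. C ^ k * real n powr (-2))"
    by (intro summable_mult) (simp add: summable_real_powr_iff)
  then show ?thesis using bound by (rule summable_comparison_test')
qed

section \<open>Optimal play for the total payoff\<close>

text \<open>
  The value of the game with \<open>n\<close> stages for the total payoff; \<open>p\<close> says whether Player 1 moves first.
\<close>

primrec total_value :: "'a pair_pre_digraph \<Rightarrow> ('a \<Rightarrow> real) \<Rightarrow> nat \<Rightarrow> bool \<Rightarrow> 'a \<Rightarrow> real" where
  "total_value \<Gamma> g 0 p z = 0"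
| "total_value \<Gamma> g (Suc n) p z =
     (if p then Max else Min) ((\<lambda>w. g w + total_value \<Gamma> g n (\<not> p) w) ` (parcs \<Gamma> `` {z}))"

text \<open>
  After a history of length \<open>i + 1\<close>, \<open>N - i\<close> stages of the \<open>N\<close>-stage game remain, and its parity says
  who moves. Hence a single function is an optimal strategy of either player.
\<close>

definition greedy :: "'a pair_pre_digraph \<Rightarrow> ('a \<Rightarrow> real) \<Rightarrow> nat \<Rightarrow> 'a list \<Rightarrow> 'a" where
  "greedy \<Gamma> g N xs = (SOME w. (last xs, w) \<in> parcs \<Gamma> \<and> (length xs \<le> N \<longrightarrow>
     total_value \<Gamma> g (Suc N - length xs) (odd (length xs)) (last xs) =
       g w + total_value \<Gamma> g (N - length xs) (even (length xs)) w))"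

text \<open>These are conditions on the graph alone: in this context the payoffs \<open>g\<close>
  are one fixed realisation and all statements are deterministic.\<close>

locale game_graph = pair_wf_digraph \<Gamma> for \<Gamma> :: "'a pair_pre_digraph" +
  assumes finite_succ: "\<And>z. z \<in> pverts \<Gamma> \<Longrightarrow> finite (parcs \<Gamma> `` {z})"
    and succ_nonempty: "\<And>z. z \<in> pverts \<Gamma> \<Longrightarrow> parcs \<Gamma> `` {z} \<noteq> {}"
    and acyclic_arcs: "acyclic (parcs \<Gamma>)"
begin

abbreviation "val \<equiv> total_value \<Gamma>"

section \<open>Backward recursion for the total value\<close>

lemma succ_finite: "finite (parcs \<Gamma> `` {z})"
proof (cases "z \<in> pverts \<Gamma>")
  case False
  then have "parcs \<Gamma> `` {z} = {}" using in_arcsD1 by blast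
  then show ?thesis by simp
qed (rule finite_succ)

lemma total_max: "(z, w) \<in> parcs \<Gamma> \<Longrightarrow> g w + val g n False w \<le> val g (Suc n) True z"
  using succ_finite[of z] by (auto intro!: Max_ge)

lemma total_min: "(z, w) \<in> parcs \<Gamma> \<Longrightarrow> val g (Suc n) False z \<le> g w + val g n True w"
  using succ_finite[of z] by (auto intro!: Min_le)

lemma total_attained:
  assumes "z \<in> pverts \<Gamma>"
  shows "\<exists>w. (z, w) \<in> parcs \<Gamma> \<and> val g (Suc n) p z = g w + val g n (\<not> p) w"
proof -
  let ?A = "(\<lambda>w. g w + val g n (\<not> p) w) ` (parcs \<Gamma> `` {z})"
  have "Max ?A \<in> ?A" "Min ?A \<in> ?A"
    using finite_succ[OF assms] succ_nonempty[OF assms] by (intro Max_in Min_in; simp)+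
  then show ?thesis by (cases p) auto
qed

text \<open>Exchanging the roles of the players, this turns lower bounds into upper bounds.\<close>

lemma total_uminus:
  assumes "z \<in> pverts \<Gamma>"
  shows "val (\<lambda>x. - g x) n p z = - val g n (\<not> p) z"
  using assms
proof (induction n arbitrary: p z)
  case (Suc n)
  let ?h = "\<lambda>w. g w + val g n p w"
  have "(\<lambda>w. - g w + val (\<lambda>x. - g x) n (\<not> p) w) ` (parcs \<Gamma> `` {z}) = uminus ` ?h ` (parcs \<Gamma> `` {z})"
    unfolding image_image using Suc.IH in_arcsD2 by (intro image_cong) auto
  moreover have "Max (uminus ` A) = - Min A" "Min (uminus ` A) = - Max A"
    if "finite A" "A \<noteq> {}" for A :: "real set"
    using that by (simp_all add: minus_Min_eq_Max minus_Max_eq_Min)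
  ultimately show ?case
    using finite_succ[OF Suc.prems] succ_nonempty[OF Suc.prems] by simp
qed simp

lemma total_bounded:
  assumes "\<And>x. l \<le> g x" "\<And>x. g x \<le> u" "z \<in> pverts \<Gamma>"
  shows "real n * l \<le> val g n p z \<and> val g n p z \<le> real n * u"
  using assms(3)
proof (induction n arbitrary: p z)
  case (Suc n)
  obtain w where w: "(z, w) \<in> parcs \<Gamma>" "val g (Suc n) p z = g w + val g n (\<not> p) w"
    using total_attained[OF Suc.prems] by blast
  then have "real n * l \<le> val g n (\<not> p) w \<and> val g n (\<not> p) w \<le> real n * u"
    by (intro Suc.IH) (auto dest: in_arcsD2)
  then show ?case
    using w(2) assms(1,2)[of w] by (simp add: algebra_simps)
qed simp

text \<open>The game with \<open>n + m\<close> stages is the one with \<open>n\<close> stages whose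
  terminal payoff is the value of the rest instead of 0; maxima and minima are monotone, so a
  terminal payoff of at least \<open>A\<close> raises the value by at least \<open>A\<close>. Player
  1 is to move at depth \<open>n\<close> exactly if \<open>p = even n\<close>.\<close>

lemma total_add_ge:
  assumes "z \<in> pverts \<Gamma>"
    and "\<And>w. (z, w) \<in> parcs \<Gamma> ^^ n \<Longrightarrow> A \<le> val g m (p = even n) w"
  shows "val g n p z + A \<le> val g (n + m) p z"
  using assms
proof (induction n arbitrary: p z)
  case 0
  then show ?case by simp
next
  case (Suc n)
  have IH: "val g n (\<not> p) w + A \<le> val g (n + m) (\<not> p) w" if "(z, w) \<in> parcs \<Gamma>" for w
  proof (rule Suc.IH)
    show "w \<in> pverts \<Gamma>" using that by (rule in_arcsD2)
    show "A \<le> val g m ((\<not> p) = even n) w'" if "(w, w') \<in> parcs \<Gamma> ^^ n" for w'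
      using Suc.prems(2)[OF relpow_Suc_I2[OF \<open>(z, w) \<in> _\<close> that]] by (cases p; cases "even n") auto
  qed
  show ?case
  proof (cases p)
    case True
    obtain w where w: "(z, w) \<in> parcs \<Gamma>" "val g (Suc n) p z = g w + val g n (\<not> p) w"
      using total_attained[OF Suc.prems(1)] by blast
    then show ?thesis
      using IH[OF w(1)] total_max[OF w(1), of g "n + m"] True by simp
  next
    case False
    obtain w where w: "(z, w) \<in> parcs \<Gamma>" "val g (Suc (n + m)) p z = g w + val g (n + m) (\<not> p) w"
      using total_attained[OF Suc.prems(1)] by blast
    then show ?thesis
      using IH[OF w(1)] total_min[OF w(1), of g n] False by simp
  qed
qed

lemma total_cong:
  assumes "\<And>w. w \<in> reachable_within \<Gamma> n z \<Longrightarrow> g w = h w"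
  shows "val g n p z = val h n p z"
  using assms
proof (induction n arbitrary: p z)
  case (Suc n)
  have "g w + val g n (\<not> p) w = h w + val h n (\<not> p) w" if "(z, w) \<in> parcs \<Gamma>" for w
  proof -
    have R: "reachable_within \<Gamma> n w \<subseteq> reachable_within \<Gamma> (Suc n) z"
      unfolding reachable_within_def using that by (auto intro: relpow_Suc_I2 exI[of _ "Suc _"])
    moreover have "w \<in> reachable_within \<Gamma> n w"
      unfolding reachable_within_def by (auto intro: exI[of _ 0])
    ultimately have "g w = h w" using Suc.prems by blast
    moreover have "val g n (\<not> p) w = val h n (\<not> p) w"
      by (rule Suc.IH) (use R Suc.prems in blast)
    ultimately show ?thesis by simp
  qed
  then have "(\<lambda>w. g w + val g n (\<not> p) w) ` (parcs \<Gamma> `` {z}) = (\<lambda>w. h w + val h n (\<not> p) w) ` (parcs \<Gamma> `` {z})"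
    by (intro image_cong) auto
  then show ?case by simp
qed simp

lemma total_measurable:
  assumes "\<And>x. x \<in> reachable_within \<Gamma> n z \<Longrightarrow> (\<lambda>\<omega>. g \<omega> x) \<in> borel_measurable N"
  shows "(\<lambda>\<omega>. val (g \<omega>) n p z) \<in> borel_measurable N"
  using assms
proof (induction n arbitrary: p z)
  case (Suc n)
  have *: "(\<lambda>\<omega>. g \<omega> w + val (g \<omega>) n (\<not> p) w) \<in> borel_measurable N" if "(z, w) \<in> parcs \<Gamma>" for w
  proof -
    have R: "reachable_within \<Gamma> n w \<subseteq> reachable_within \<Gamma> (Suc n) z"
      unfolding reachable_within_def using that by (auto intro: relpow_Suc_I2 exI[of _ "Suc _"])
    moreover have "w \<in> reachable_within \<Gamma> n w"
      unfolding reachable_within_def by (auto intro: exI[of _ 0])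
    ultimately show ?thesis
      using Suc.prems by (intro borel_measurable_add Suc.IH) blast+
  qed
  show ?case
    using succ_finite[of z] *
    by (cases p) (auto intro!: borel_measurable_Max borel_measurable_Min)
qed simp

section \<open>Plays and optimal strategies\<close>

lemma length_history [simp]: "length (history \<sigma> \<tau> z i) = Suc i"
  by (induction i) auto

lemma trajectory_0 [simp]: "trajectory \<sigma> \<tau> z 0 = z"
  by (simp add: trajectory_def)

lemma trajectory_Suc:
  "trajectory \<sigma> \<tau> z (Suc i) = (if even i then \<sigma> (history \<sigma> \<tau> z i) else \<tau> (history \<sigma> \<tau> z i))"
  by (simp add: trajectory_def)

lemma history_in_verts:
  assumes "\<sigma> \<in> strategies1 \<Gamma>" "\<tau> \<in> strategies2 \<Gamma>" "z \<in> pverts \<Gamma>"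
  shows "set (history \<sigma> \<tau> z i) \<subseteq> pverts \<Gamma> \<and>
    (trajectory \<sigma> \<tau> z i, trajectory \<sigma> \<tau> z (Suc i)) \<in> parcs \<Gamma>"
proof (induction i)
  case 0
  have "(last [z], \<sigma> [z]) \<in> parcs \<Gamma>"
    using assms(1)[unfolded strategies1_def, THEN CollectD, THEN spec, of "[z]"] assms(3) by simp
  then show ?case using assms by (simp add: trajectory_Suc)
next
  case (Suc i)
  let ?h = "history \<sigma> \<tau> z (Suc i)"
  have "set ?h \<subseteq> pverts \<Gamma>"
    using Suc in_arcsD2 by (auto simp: trajectory_Suc)
  moreover have len: "length ?h = Suc (Suc i)" by (rule length_history)
  moreover have "?h \<noteq> []" using len by (metis list.size(3) nat.distinct(1))
  ultimately have "even i \<Longrightarrow> (last ?h, \<tau> ?h) \<in> parcs \<Gamma>" "odd i \<Longrightarrow> (last ?h, \<sigma> ?h) \<in> parcs \<Gamma>"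
    using assms(1,2) unfolding strategies1_def strategies2_def
    by (auto simp del: history.simps)
  then show ?case
    using \<open>set ?h \<subseteq> pverts \<Gamma>\<close> 
    by (simp add: trajectory_Suc[of \<sigma> \<tau> z "Suc i"] trajectory_def[of \<sigma> \<tau> z "Suc i"] del: history.simps)
qed

lemma trajectory_in_verts:
  assumes "\<sigma> \<in> strategies1 \<Gamma>" "\<tau> \<in> strategies2 \<Gamma>" "z \<in> pverts \<Gamma>"
  shows "trajectory \<sigma> \<tau> z i \<in> pverts \<Gamma>"
  using history_in_verts[OF assms] in_arcsD1 by blast

lemma trajectory_relpow:
  assumes "\<sigma> \<in> strategies1 \<Gamma>" "\<tau> \<in> strategies2 \<Gamma>" "z \<in> pverts \<Gamma>"
  shows "(z, trajectory \<sigma> \<tau> z i) \<in> parcs \<Gamma> ^^ i"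
proof (induction i)
  case (Suc i)
  then show ?case using history_in_verts[OF assms] by auto
qed simp

lemma greedy:
  assumes "last xs \<in> pverts \<Gamma>"
  shows greedy_arc: "(last xs, greedy \<Gamma> g N xs) \<in> parcs \<Gamma>" (is ?arc)
    and greedy_total: "length xs \<le> N \<Longrightarrow>
      val g (Suc N - length xs) (odd (length xs)) (last xs) =
        g (greedy \<Gamma> g N xs) + val g (N - length xs) (even (length xs)) (greedy \<Gamma> g N xs)"
        (is "_ \<Longrightarrow> ?eq")
proof -
  have "\<exists>w. (last xs, w) \<in> parcs \<Gamma> \<and> (length xs \<le> N \<longrightarrow>
     val g (Suc N - length xs) (odd (length xs)) (last xs) =
       g w + val g (N - length xs) (even (length xs)) w)"
    using total_attained[OF assms, of g "N - length xs" "odd (length xs)"]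
    by (auto simp: Suc_diff_le simp del: total_value.simps)
  from someI_ex[OF this] show ?arc "length xs \<le> N \<Longrightarrow> ?eq"
    unfolding greedy_def by blast+
qed

lemma greedy_strategies [simp]: "greedy \<Gamma> g N \<in> strategies1 \<Gamma>" "greedy \<Gamma> g N \<in> strategies2 \<Gamma>"
proof -
  have "(last xs, greedy \<Gamma> g N xs) \<in> parcs \<Gamma>" if "set xs \<subseteq> pverts \<Gamma>" "xs \<noteq> []" for xs
    using that by (intro greedy_arc) auto
  moreover have "odd (length xs) \<Longrightarrow> xs \<noteq> []" for xs :: "'a list" by auto
  ultimately show "greedy \<Gamma> g N \<in> strategies1 \<Gamma>" "greedy \<Gamma> g N \<in> strategies2 \<Gamma>"
    unfolding strategies1_def strategies2_def by blast+
qed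

text \<open>The payoff collected so far plus the value of the remaining stages is unchanged by a
  greedy move of Player 1 and cannot decrease at a move of Player 2, who faces a minimum. The case
  \<open>n = N\<close> is optimality; \<open>n < N\<close> allows the play to be stopped at a visit
  to a chosen set.\<close>

lemma greedy1_ge:
  assumes "\<tau> \<in> strategies2 \<Gamma>" "z \<in> pverts \<Gamma>" "n \<le> N"
  shows "val g N True z \<le> (\<Sum>i=1..n. g (trajectory (greedy \<Gamma> g N) \<tau> z i)) +
    val g (N - n) (even n) (trajectory (greedy \<Gamma> g N) \<tau> z n)"
  using \<open>n \<le> N\<close>
proof (induction n)
  case (Suc n)
  let ?\<sigma> = "greedy \<Gamma> g N"
  let ?z = "trajectory ?\<sigma> \<tau> z n" and ?w = "trajectory ?\<sigma> \<tau> z (Suc n)"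
  note st = greedy_strategies(1) assms(1,2)
  have arc: "(?z, ?w) \<in> parcs \<Gamma>" using history_in_verts[OF st] by blast
  have z: "last (history ?\<sigma> \<tau> z n) \<in> pverts \<Gamma>"
    using trajectory_in_verts[OF st] by (simp add: trajectory_def)
  have "val g (N - n) (even n) ?z \<le> g ?w + val g (N - Suc n) (odd n) ?w"
  proof (cases "even n")
    case True
    then show ?thesis
      using greedy_total[OF z, of N g] Suc.prems by (simp add: trajectory_Suc trajectory_def)
  next
    case False
    then show ?thesis
      using total_min[OF arc, of g "N - Suc n"] Suc.prems by (simp add: Suc_diff_Suc del: total_value.simps)
  qed
  then show ?case using Suc by (simp del: total_value.simps)
qed simp

lemma greedy2_le:
  assumes "\<sigma> \<in> strategies1 \<Gamma>" "z \<in> pverts \<Gamma>" "n \<le> N"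
  shows "(\<Sum>i=1..n. g (trajectory \<sigma> (greedy \<Gamma> g N) z i)) +
    val g (N - n) (even n) (trajectory \<sigma> (greedy \<Gamma> g N) z n) \<le> val g N True z"
  using \<open>n \<le> N\<close>
proof (induction n)
  case (Suc n)
  let ?\<tau> = "greedy \<Gamma> g N"
  let ?z = "trajectory \<sigma> ?\<tau> z n" and ?w = "trajectory \<sigma> ?\<tau> z (Suc n)"
  note st = assms(1) greedy_strategies(2) assms(2)
  have arc: "(?z, ?w) \<in> parcs \<Gamma>" using history_in_verts[OF st] by blast
  have z: "last (history \<sigma> ?\<tau> z n) \<in> pverts \<Gamma>"
    using trajectory_in_verts[OF st] by (simp add: trajectory_def)
  have "g ?w + val g (N - Suc n) (odd n) ?w \<le> val g (N - n) (even n) ?z"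
  proof (cases "even n")
    case False
    then show ?thesis
      using greedy_total[OF z, of N g] Suc.prems by (simp add: trajectory_Suc trajectory_def)
  next
    case True
    then show ?thesis
      using total_max[OF arc, of g "N - Suc n"] Suc.prems by (simp add: Suc_diff_Suc del: total_value.simps)
  qed
  then show ?case using Suc by (simp del: total_value.simps)
qed simp

lemma finite_reachable_within: "finite (reachable_within \<Gamma> n z)"
proof -
  have "finite ((parcs \<Gamma> ^^ k) `` {z})" for k
  proof (induction k)
    case (Suc k)
    have "(parcs \<Gamma> ^^ Suc k) `` {z} = (\<Union>w\<in>(parcs \<Gamma> ^^ k) `` {z}. parcs \<Gamma> `` {w})" by auto
    then show ?case using Suc succ_finite by auto
  qed simp
  moreover have "reachable_within \<Gamma> n z = (\<Union>k\<le>n. (parcs \<Gamma> ^^ k) `` {z})"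
    by (auto simp: reachable_within_def)
  ultimately show ?thesis by auto
qed

text \<open>The greedy strategies of both players guarantee the recursive value from either side, so
  they form a saddle point.\<close>

lemma game_value_eq_total:
  assumes "z \<in> pverts \<Gamma>"
  shows "game_value \<Gamma> g n z = val g n True z / real n"
proof -
  let ?F = "\<lambda>f. 1 / real n * (\<Sum>i=1..n. g (f i))"
  \<comment> \<open>The sets of strategies are infinite, but \<open>Max\<close> and
    \<open>Min\<close> obey their laws only on finite sets. A payoff depends on \<open>n\<close>
    positions in a finite set, so all payoffs lie in the finite set \<open>?A\<close>.\<close>
  let ?A = "?F ` ({1..n} \<rightarrow>\<^sub>E reachable_within \<Gamma> n z)"
  have A: "finite ?A" by (intro finite_imageI finite_PiE) (auto simp: finite_reachable_within)
  have payA: "stage_payoff g n z \<sigma> \<tau> \<in> ?A" if "\<sigma> \<in> strategies1 \<Gamma>" "\<tau> \<in> strategies2 \<Gamma>" for \<sigma> \<tau>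
  proof (rule image_eqI)
    show "stage_payoff g n z \<sigma> \<tau> = ?F (restrict (trajectory \<sigma> \<tau> z) {1..n})"
      by (simp add: stage_payoff_def)
    show "restrict (trajectory \<sigma> \<tau> z) {1..n} \<in> {1..n} \<rightarrow>\<^sub>E reachable_within \<Gamma> n z"
      using trajectory_relpow[OF that assms] by (auto simp: reachable_within_def)
  qed
  let ?g = "greedy \<Gamma> g n" and ?v = "val g n True z / real n"
  have le: "stage_payoff g n z \<sigma> ?g \<le> ?v" if "\<sigma> \<in> strategies1 \<Gamma>" for \<sigma>
    using greedy2_le[OF that assms order_refl, of g n]
    by (simp add: stage_payoff_def divide_right_mono)
  have ge: "?v \<le> stage_payoff g n z ?g \<tau>" if "\<tau> \<in> strategies2 \<Gamma>" for \<tau>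
    using greedy1_ge[OF that assms order_refl, of g n]
    by (simp add: stage_payoff_def divide_right_mono)
  let ?m = "\<lambda>\<sigma>. MIN \<tau>\<in>strategies2 \<Gamma>. stage_payoff g n z \<sigma> \<tau>"
  have finT: "finite (stage_payoff g n z \<sigma> ` strategies2 \<Gamma>)" if "\<sigma> \<in> strategies1 \<Gamma>" for \<sigma>
    using payA[OF that] by (intro finite_subset[OF _ A]) blast
  have neT: "strategies2 \<Gamma> \<noteq> {}" using greedy_strategies(2) by blast
  have mA: "?m \<sigma> \<in> ?A" if "\<sigma> \<in> strategies1 \<Gamma>" for \<sigma>
  proof -
    have "?m \<sigma> \<in> stage_payoff g n z \<sigma> ` strategies2 \<Gamma>"
      using neT by (intro Min_in finT that) auto
    then show ?thesis using payA[OF that] by auto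
  qed
  have "(MAX \<sigma>\<in>strategies1 \<Gamma>. ?m \<sigma>) = ?v"
  proof (rule Max_eqI)
    show "finite (?m ` strategies1 \<Gamma>)" using mA by (intro finite_subset[OF _ A]) blast
    have mle: "?m \<sigma> \<le> stage_payoff g n z \<sigma> ?g" if "\<sigma> \<in> strategies1 \<Gamma>" for \<sigma>
      by (intro Min_le finT that) auto
    then show "y \<le> ?v" if "y \<in> ?m ` strategies1 \<Gamma>" for y
      using that le order_trans by blast
    have "?v \<le> ?m ?g"
      using neT ge by (subst Min_ge_iff) (auto intro: finT)
    moreover have "?m ?g \<le> ?v" using mle[of ?g] le[of ?g] by simp
    ultimately show "?v \<in> ?m ` strategies1 \<Gamma>" using greedy_strategies(1) by (metis antisym image_eqI)
  qed
  then show ?thesis by (simp add: game_value_def)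
qed

section \<open>Effect of the payoffs in one part\<close>

text \<open>Let Player 1 play optimally for \<open>g\<close> against Player 2 playing optimally for
  \<open>h\<close>. Along this one play the total for \<open>g\<close> is at least the first value
  and the total for \<open>h\<close> at most the second one, and the two totals differ only at the
  single possible visit to \<open>B\<close>.\<close>

lemma total_le_block:
  assumes z: "z \<in> pverts \<Gamma>" and eq: "\<And>x. x \<notin> B \<Longrightarrow> g x = h x" and le: "\<And>x. g x \<le> h x + 1"
    and once: "\<And>\<sigma> \<tau> j k. \<sigma> \<in> strategies1 \<Gamma> \<Longrightarrow> \<tau> \<in> strategies2 \<Gamma> \<Longrightarrow>
      trajectory \<sigma> \<tau> z j \<in> B \<Longrightarrow> trajectory \<sigma> \<tau> z k \<in> B \<Longrightarrow> j = k"
  shows "val g n True z \<le> val h n True z + 1"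
proof -
  let ?f = "trajectory (greedy \<Gamma> g n) (greedy \<Gamma> h n) z"
  let ?I = "{i \<in> {1..n}. ?f i \<in> B}"
  have "j = k" if "?f j \<in> B" "?f k \<in> B" for j k
    using once[OF greedy_strategies(1,2) that] .
  then have "card ?I \<le> 1"
    using card_le_Suc0_iff_eq[of ?I] by auto
  have "(\<Sum>i=1..n. g (?f i)) \<le> (\<Sum>i=1..n. h (?f i) + (if ?f i \<in> B then 1 else 0))"
    by (intro sum_mono) (use eq le in auto)
  also have "\<dots> = (\<Sum>i=1..n. h (?f i)) + (\<Sum>i=1..n. if ?f i \<in> B then 1 else 0)"
    by (rule sum.distrib)
  also have "(\<Sum>i=1..n. if ?f i \<in> B then 1 else 0 :: real) = real (card ?I)"
    by (subst sum.inter_filter[symmetric]) auto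
  finally have "(\<Sum>i=1..n. g (?f i)) \<le> (\<Sum>i=1..n. h (?f i)) + 1"
    using \<open>card ?I \<le> 1\<close> by linarith
  moreover have "val g n True z \<le> (\<Sum>i=1..n. g (?f i))"
    using greedy1_ge[of "greedy \<Gamma> h n" z n n g] z by simp
  moreover have "(\<Sum>i=1..n. h (?f i)) \<le> val h n True z"
    using greedy2_le[of "greedy \<Gamma> g n" z n n h] z by simp
  ultimately show ?thesis by linarith
qed

text \<open>The definition speaks of the parts with \<open>i \<ge> 1\<close> only. The part
  \<open>{z}\<close> obeys the same rule since a return to \<open>z\<close> would close a directed
  cycle.\<close>

lemma adapted_partition_once:
  assumes "adapted_partition \<Gamma> z Q" "z \<in> pverts \<Gamma>" "\<sigma> \<in> strategies1 \<Gamma>" "\<tau> \<in> strategies2 \<Gamma>"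
    "trajectory \<sigma> \<tau> z j \<in> Q i" "trajectory \<sigma> \<tau> z k \<in> Q i"
  shows "j = k"
proof (cases "i = 0")
  case True
  have "j = 0" if "trajectory \<sigma> \<tau> z j = z" for j
  proof (rule ccontr)
    assume "j \<noteq> 0"
    moreover have "(z, z) \<in> parcs \<Gamma> ^^ j"
      using trajectory_relpow[OF assms(3,4,2), of j] that by simp
    ultimately have "(z, z) \<in> (parcs \<Gamma>)\<^sup>+" by (auto simp: trancl_power)
    then show False using acyclic_arcs by (simp add: acyclic_def)
  qed
  moreover have "trajectory \<sigma> \<tau> z j = z" "trajectory \<sigma> \<tau> z k = z"
    using assms(1,5,6) True by (auto simp: adapted_partition_def)
  ultimately show ?thesis by metis
next
  case False
  then show ?thesis using assms unfolding adapted_partition_def by (metis One_nat_def Suc_leI neq0_conv)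
qed

section \<open>Splitting a game after some stages and steering the token\<close>

lemma total_add_le:
  assumes "z \<in> pverts \<Gamma>"
    and "\<And>w. (z, w) \<in> parcs \<Gamma> ^^ n \<Longrightarrow> val g m (p = even n) w \<le> A"
  shows "val g (n + m) p z \<le> val g n p z + A"
proof -
  have in_verts: "w \<in> pverts \<Gamma>" if "(z, w) \<in> parcs \<Gamma> ^^ n" for w
    using that assms(1) by (cases n) (auto dest: in_arcsD2)
  have "val (\<lambda>x. - g x) n (\<not> p) z + - A \<le> val (\<lambda>x. - g x) (n + m) (\<not> p) z"
    using assms by (intro total_add_ge) (auto simp: total_uminus in_verts)
  then show ?thesis using assms(1) by (simp add: total_uminus)
qed

lemma total_lipschitz:
  assumes g: "\<forall>x. \<bar>g x\<bar> \<le> 1" and z: "z \<in> pverts \<Gamma>"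
  shows "\<bar>val g (n + m) p z - val g n p z\<bar> \<le> real m"
proof -
  have g': "- 1 \<le> g x" "g x \<le> 1" for x using g[rule_format, of x] by auto
  have in_verts: "w \<in> pverts \<Gamma>" if "(z, w) \<in> parcs \<Gamma> ^^ n" for w
    using that z by (cases n) (auto dest: in_arcsD2)
  have "- real m \<le> val g m q w \<and> val g m q w \<le> real m" if "w \<in> pverts \<Gamma>" for q w
    using total_bounded[of "- 1" g 1, OF g' that, of m q] by simp
  then show ?thesis
    using total_add_ge[OF z, of n "- real m" g m p] total_add_le[OF z, of n g m p "real m"] in_verts
    by fastforce
qed

text \<open>If Player 1 can force a visit to \<open>T\<close> at an even stage, let the opponent answer optimally.\<close>

lemma force_ge:
  assumes g: "\<forall>x. \<bar>g x\<bar> \<le> 1" and z: "z \<in> pverts \<Gamma>" and \<sigma>: "\<sigma> \<in> strategies1 \<Gamma>"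
    and T: "\<And>\<tau>. \<tau> \<in> strategies2 \<Gamma> \<Longrightarrow> \<exists>l\<le>L. even l \<and> T (trajectory \<sigma> \<tau> z l)"
  shows "\<exists>w\<in>reachable_within \<Gamma> L z. T w \<and> val g N True w - 2 * real L \<le> val g N True z"
proof -
  let ?\<tau> = "greedy \<Gamma> g N"
  obtain l where l: "l \<le> L" "even l" "T (trajectory \<sigma> ?\<tau> z l)"
    using T[OF greedy_strategies(2)] by blast
  let ?w = "trajectory \<sigma> ?\<tau> z l"
  note st = \<sigma> greedy_strategies(2) z
  have w: "?w \<in> pverts \<Gamma>" by (rule trajectory_in_verts[OF st])
  have "?w \<in> reachable_within \<Gamma> L z"
    using trajectory_relpow[OF st] l(1) by (auto simp: reachable_within_def)
  moreover have "val g N True ?w - 2 * real L \<le> val g N True z"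
  \<comment> \<open>The visit takes place at an even stage, so Player 1 is to move again. The stages
    before it cost at most \<open>l\<close>, and having only \<open>N - l\<close> stages left costs
    another \<open>l\<close>; this gives \<open>2 * L\<close>. If the visit comes after the end of
    the game, both values are at most \<open>N < L\<close> in absolute value.\<close>
  proof (cases "l \<le> N")
    case True
    have "(\<Sum>i=1..l. - 1) \<le> (\<Sum>i=1..l. g (trajectory \<sigma> ?\<tau> z i))"
      using g by (intro sum_mono) (auto simp: abs_le_iff minus_le_iff)
    moreover have "val g N True ?w \<le> val g (N - l) True ?w + real l"
      using total_lipschitz[OF g w, of "N - l" l True] True by simp
    ultimately show ?thesis
      using greedy2_le[OF \<sigma> z True, of g] l(1,2) by simp
  next
    case False
    then show ?thesis
      using total_lipschitz[OF g w, of 0 N True] total_lipschitz[OF g z, of 0 N True] l(1) by simp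
  qed
  ultimately show ?thesis using l(3) by blast
qed

lemma force_le:
  assumes g: "\<forall>x. \<bar>g x\<bar> \<le> 1" and z: "z \<in> pverts \<Gamma>" and \<tau>: "\<tau> \<in> strategies2 \<Gamma>"
    and T: "\<And>\<sigma>. \<sigma> \<in> strategies1 \<Gamma> \<Longrightarrow> \<exists>l\<le>L. even l \<and> T (trajectory \<sigma> \<tau> z l)"
  shows "\<exists>w\<in>reachable_within \<Gamma> L z. T w \<and> val g N True z \<le> val g N True w + 2 * real L"
proof -
  let ?\<sigma> = "greedy \<Gamma> g N"
  obtain l where l: "l \<le> L" "even l" "T (trajectory ?\<sigma> \<tau> z l)"
    using T[OF greedy_strategies(1)] by blast
  let ?w = "trajectory ?\<sigma> \<tau> z l"
  note st = greedy_strategies(1) \<tau> z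
  have w: "?w \<in> pverts \<Gamma>" by (rule trajectory_in_verts[OF st])
  have "?w \<in> reachable_within \<Gamma> L z"
    using trajectory_relpow[OF st] l(1) by (auto simp: reachable_within_def)
  moreover have "val g N True z \<le> val g N True ?w + 2 * real L"
  proof (cases "l \<le> N")
    case True
    have "(\<Sum>i=1..l. g (trajectory ?\<sigma> \<tau> z i)) \<le> (\<Sum>i=1..l. 1)"
      using g by (intro sum_mono) (auto simp: abs_le_iff)
    moreover have "val g (N - l) True ?w \<le> val g N True ?w + real l"
      using total_lipschitz[OF g w, of "N - l" l True] True by simp
    ultimately show ?thesis
      using greedy1_ge[OF \<tau> z True, of g] l(1,2) by simp
  next
    case False
    then show ?thesis
      using total_lipschitz[OF g w, of 0 N True] total_lipschitz[OF g z, of 0 N True] l(1) by simp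
  qed
  ultimately show ?thesis using l(3) by blast
qed

text \<open>After an odd number of stages Player 2 is to move, whereas forcing is available only in
  games that Player 1 opens. One optimal move of Player 2 repairs this: its payoff and the one stage
  by which the two lengths differ cost at most 1 each.\<close>

lemma total_turn:
  assumes g: "\<forall>x. \<bar>g x\<bar> \<le> 1" and w: "w \<in> pverts \<Gamma>"
  shows "\<exists>v. (w, v) \<in> parcs \<Gamma> \<and> \<bar>val g m False w - val g m True v\<bar> \<le> 2"
proof (cases m)
  case 0
  then show ?thesis using succ_nonempty[OF w] by auto
next
  case (Suc k)
  obtain v where v: "(w, v) \<in> parcs \<Gamma>" "val g m False w = g v + val g k True v"
    using total_attained[OF w, of g k False] Suc by auto
  have "\<bar>val g (k + 1) True v - val g k True v\<bar> \<le> 1"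
    using total_lipschitz[OF g in_arcsD2[OF v(1)], of k 1 True] by simp
  then have "\<bar>val g m False w - val g m True v\<bar> \<le> 2"
    using g[rule_format, of v] unfolding v(2) by (simp add: Suc del: total_value.simps)
  then show ?thesis using v(1) by blast
qed

text \<open>From any position at depth \<open>n\<close>, after one extra move if \<open>n\<close> is
  odd, Player 1 can force a state in \<open>T\<close>, which bounds the remaining value from below,
  and Player 2 can force one, which bounds it from above. The two states may differ, but both have
  an \<open>m\<close>-stage value close to \<open>a\<close>. The error is \<open>d\<close>, plus
  \<open>2 * L\<close> for the steering and 2 for the extra move.\<close>

lemma weakly_transitive_concat:
  assumes g: "\<forall>x. \<bar>g x\<bar> \<le> 1" and z: "z \<in> pverts \<Gamma>"
    and force: "\<And>w. w \<in> pverts \<Gamma> \<Longrightarrow>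
     (\<exists>\<sigma>\<in>strategies1 \<Gamma>. \<forall>\<tau>\<in>strategies2 \<Gamma>. \<exists>l\<le>L. even l \<and> T (trajectory \<sigma> \<tau> w l)) \<and>
     (\<exists>\<tau>\<in>strategies2 \<Gamma>. \<forall>\<sigma>\<in>strategies1 \<Gamma>. \<exists>l\<le>L. even l \<and> T (trajectory \<sigma> \<tau> w l))"
    and T: "\<And>w. w \<in> reachable_within \<Gamma> (n + 1 + L) z \<Longrightarrow> T w \<Longrightarrow> \<bar>val g m True w - a\<bar> \<le> d"
  shows "\<bar>val g (n + m) True z - val g n True z - a\<bar> \<le> d + 2 * real L + 2"
proof -
  have "a - (d + 2 * real L + 2) \<le> val g m (even n) w \<and> val g m (even n) w \<le> a + (d + 2 * real L + 2)"
    if w: "(z, w) \<in> parcs \<Gamma> ^^ n" for w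
  proof -
    have wv: "w \<in> pverts \<Gamma>" using w z by (cases n) (auto dest: in_arcsD2)
    obtain v k where v: "k \<le> n + 1" "(z, v) \<in> parcs \<Gamma> ^^ k" "v \<in> pverts \<Gamma>"
      "\<bar>val g m (even n) w - val g m True v\<bar> \<le> 2"
    proof (cases "even n")
      case True
      then show ?thesis using that[of n w] w wv by simp
    next
      case False
      obtain v where "(w, v) \<in> parcs \<Gamma>" "\<bar>val g m False w - val g m True v\<bar> \<le> 2"
        using total_turn[OF g wv] by blast
      then show ?thesis using that[of "n + 1" v] w False in_arcsD2 by auto
    qed
    have R: "reachable_within \<Gamma> L v \<subseteq> reachable_within \<Gamma> (n + 1 + L) z"
    proof
      fix u assume "u \<in> reachable_within \<Gamma> L v"
      then obtain j where "j \<le> L" "(v, u) \<in> parcs \<Gamma> ^^ j" by (auto simp: reachable_within_def)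
      then have "(z, u) \<in> parcs \<Gamma> ^^ (k + j)" using v(2) by (auto simp: relpow_add)
      moreover have "k + j \<le> n + 1 + L" using v(1) \<open>j \<le> L\<close> by simp
      ultimately show "u \<in> reachable_within \<Gamma> (n + 1 + L) z" unfolding reachable_within_def by blast
    qed
    obtain u where u: "u \<in> reachable_within \<Gamma> L v" "T u" "val g m True u - 2 * real L \<le> val g m True v"
      using force[OF v(3)] force_ge[OF g v(3), of _ L T m] by blast
    obtain u' where u': "u' \<in> reachable_within \<Gamma> L v" "T u'" "val g m True v \<le> val g m True u' + 2 * real L"
      using force[OF v(3)] force_le[OF g v(3), of _ L T m] by blast
    have "\<bar>val g m True u - a\<bar> \<le> d" "\<bar>val g m True u' - a\<bar> \<le> d"
      using T u(1,2) u'(1,2) R by blast+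
    then show ?thesis using u(3) u'(3) v(4) by auto
  qed
  then have "val g n True z + (a - (d + 2 * real L + 2)) \<le> val g (n + m) True z"
    "val g (n + m) True z \<le> val g n True z + (a + (d + 2 * real L + 2))"
    using z by (intro total_add_ge total_add_le; simp)+
  then show ?thesis by linarith
qed

section \<open>Isomorphic descendant subgraphs\<close>

lemma descendants_eq: "z \<in> pverts \<Gamma> \<Longrightarrow> descendants \<Gamma> z = (parcs \<Gamma>)\<^sup>* `` {z}"
  unfolding descendants_def by (auto simp: reachable_conv')

text \<open>A set of descendants is closed under out-neighbours, so passing to the induced subgraph
  loses no move, and an isomorphism of these subgraphs carries the moves in \<Gamma> at
  \<open>u\<close> to those at \<open>\<phi> u\<close>.\<close>

lemma equivalent_states_bij:
  assumes z: "z \<in> pverts \<Gamma>" and c: "c \<in> pverts \<Gamma>" and "equivalent_states \<Gamma> z c"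
  shows "\<exists>\<phi>. bij_betw \<phi> (descendants \<Gamma> z) (descendants \<Gamma> c) \<and> \<phi> z = c \<and>
    (\<forall>u\<in>descendants \<Gamma> z. parcs \<Gamma> `` {\<phi> u} = \<phi> ` (parcs \<Gamma> `` {u}))"
proof -
  let ?Dz = "descendants \<Gamma> z" and ?Dc = "descendants \<Gamma> c"
  have closed: "v \<in> descendants \<Gamma> x" if "u \<in> descendants \<Gamma> x" "(u, v) \<in> parcs \<Gamma>" "x \<in> pverts \<Gamma>" for u v x
    using that by (auto simp: descendants_eq intro: rtrancl_into_rtrancl)
  let ?G = "with_proj \<Gamma> \<restriction> ?Dz" and ?H = "with_proj \<Gamma> \<restriction> ?Dc"
  obtain f where f: "pre_digraph.digraph_isomorphism ?G f" and H: "?H = app_iso f ?G"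
    using assms(3) unfolding equivalent_states_def digraph_iso_def by blast
  define \<phi> where "\<phi> = iso_verts f"
  have vert: "?Dc = \<phi> ` ?Dz"
    using arg_cong[OF H, of verts] by (simp add: \<phi>_def)
  have inj: "inj_on \<phi> ?Dz"
    using pre_digraph.digraph_isomorphism_inj_on_verts[OF f] by (simp add: \<phi>_def)
  have arcs: "{e \<in> parcs \<Gamma>. fst e \<in> ?Dc \<and> snd e \<in> ?Dc} = iso_arcs f ` {e \<in> parcs \<Gamma>. fst e \<in> ?Dz \<and> snd e \<in> ?Dz}"
    using arg_cong[OF H, of arcs] by simp
  \<comment> \<open>Tail and head are the projections in both digraphs, so the action of
    \<open>f\<close> on arcs is determined by its action on vertices.\<close>
  have ends: "iso_tail f = fst" "iso_head f = snd"
    using arg_cong[OF H, of tail] arg_cong[OF H, of head] by simp_all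
  have iso_arc: "iso_arcs f (u, v) = (\<phi> u, \<phi> v)" if "(u, v) \<in> parcs \<Gamma>" "u \<in> ?Dz" "v \<in> ?Dz" for u v
    using pre_digraph.iso_verts_tail[OF f, of "(u, v)"] pre_digraph.iso_verts_head[OF f, of "(u, v)"] that
    by (simp add: ends \<phi>_def prod_eq_iff)
  have succ: "parcs \<Gamma> `` {\<phi> u} = \<phi> ` (parcs \<Gamma> `` {u})" if u: "u \<in> ?Dz" for u
  proof (intro equalityI subsetI)
    fix y assume "y \<in> parcs \<Gamma> `` {\<phi> u}"
    then have y: "(\<phi> u, y) \<in> parcs \<Gamma>" by simp
    moreover have "\<phi> u \<in> ?Dc" using u vert by blast
    ultimately have "y \<in> ?Dc" using closed c by blast
    with y \<open>\<phi> u \<in> ?Dc\<close> have "(\<phi> u, y) \<in> iso_arcs f ` {e \<in> parcs \<Gamma>. fst e \<in> ?Dz \<and> snd e \<in> ?Dz}"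
      using arcs by auto
    then obtain u' v' where e: "(\<phi> u, y) = iso_arcs f (u', v')" "(u', v') \<in> parcs \<Gamma>" "u' \<in> ?Dz" "v' \<in> ?Dz"
      by auto
    then have "\<phi> u = \<phi> u'" "y = \<phi> v'" using iso_arc by auto
    then show "y \<in> \<phi> ` (parcs \<Gamma> `` {u})" using inj u e by (auto dest: inj_onD)
  next
    fix y assume "y \<in> \<phi> ` (parcs \<Gamma> `` {u})"
    then obtain v where v: "(u, v) \<in> parcs \<Gamma>" "y = \<phi> v" by auto
    then have "v \<in> ?Dz" using closed u z by blast
    then have "(\<phi> u, y) \<in> iso_arcs f ` {e \<in> parcs \<Gamma>. fst e \<in> ?Dz \<and> snd e \<in> ?Dz}"
      using iso_arc[OF v(1) u] v u by (intro image_eqI[of _ _ "(u, v)"]) auto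
    then show "y \<in> parcs \<Gamma> `` {\<phi> u}" using arcs by blast
  qed
  \<comment> \<open>Equivalence does not say that \<open>z\<close> is sent to \<open>c\<close>. But
    \<open>\<phi> z\<close> reaches every descendant of \<open>c\<close>, in particular
    \<open>c\<close>, and is itself reached from \<open>c\<close>; without cycles the two
    coincide.\<close>
  have zD: "z \<in> ?Dz" and cD: "c \<in> ?Dc" using z c by (auto simp: descendants_eq)
  have "(\<phi> z, \<phi> u) \<in> (parcs \<Gamma>)\<^sup>*" if "(z, u) \<in> (parcs \<Gamma>)\<^sup>*" for u
    using that
  proof (induction rule: rtrancl_induct)
    case (step u v)
    then have "u \<in> ?Dz" using z by (simp add: descendants_eq)
    then have "(\<phi> u, \<phi> v) \<in> parcs \<Gamma>" using succ step(2) by blast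
    then show ?case using step.IH by (rule rtrancl_into_rtrancl[rotated])
  qed simp
  then have "(\<phi> z, c) \<in> (parcs \<Gamma>)\<^sup>*"
    using cD vert z by (auto simp: descendants_eq)
  moreover have "(c, \<phi> z) \<in> (parcs \<Gamma>)\<^sup>*"
    using zD vert c by (auto simp: descendants_eq)
  ultimately have "\<phi> z = c"
    using acyclic_impl_antisym_rtrancl[OF acyclic_arcs] by (auto dest: antisymD)
  then show ?thesis using succ inj vert by (auto simp: bij_betw_def)
qed

lemma total_iso:
  assumes "\<And>u. u \<in> D \<Longrightarrow> parcs \<Gamma> `` {\<phi> u} = \<phi> ` (parcs \<Gamma> `` {u})"
    and "\<And>u. u \<in> D \<Longrightarrow> parcs \<Gamma> `` {u} \<subseteq> D" and "u \<in> D"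
  shows "val g n p (\<phi> u) = val (\<lambda>x. g (\<phi> x)) n p u"
  using assms(3)
proof (induction n arbitrary: p u)
  case (Suc n)
  have "(\<lambda>w. g w + val g n (\<not> p) w) ` (parcs \<Gamma> `` {\<phi> u})
      = (\<lambda>w. g (\<phi> w) + val (\<lambda>x. g (\<phi> x)) n (\<not> p) w) ` (parcs \<Gamma> `` {u})"
    unfolding assms(1)[OF Suc.prems] image_image
    using assms(2)[OF Suc.prems] Suc.IH by (intro image_cong) auto
  then show ?case by simp
qed simp

end

section \<open>Random payoffs\<close>

sublocale directed_game \<subseteq> game_graph \<Gamma>
proof
  fix z assume z: "z \<in> pverts \<Gamma>"
  have eq: "parcs \<Gamma> `` {z} = snd ` out_arcs \<Gamma> z" by (auto simp: out_arcs_def image_iff)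
  show "finite (parcs \<Gamma> `` {z})" unfolding eq using locally_finite[OF z] by simp
  have "out_arcs \<Gamma> z \<noteq> {}" using out_degree_nonzero[OF z] by (auto simp: out_degree_def)
  then show "parcs \<Gamma> `` {z} \<noteq> {}" unfolding eq by simp
next
  show "acyclic (parcs \<Gamma>)"
  proof (rule acyclicI, intro allI notI)
    fix z assume "(z, z) \<in> (parcs \<Gamma>)\<^sup>+"
    then obtain p where "awalk z p z" "p \<noteq> []" using reachable1_awalk by auto
    then have "closed_w p" by (auto simp: closed_w_def)
    then show False using closed_w_imp_cycle no_directed_cycle by blast
  qed
qed

section \<open>Clipped payoffs\<close>

text \<open>The payoffs lie in the unit interval only almost surely, while the concentration
  inequality needs a function that is bounded for every argument. Clipping provides this and changes
  the values on a null set only.\<close>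

definition clip :: "real \<Rightarrow> real" where
  "clip r = max 0 (min 1 r)"

lemma clip_bounds: "0 \<le> clip r" "clip r \<le> 1" "\<bar>clip r\<bar> \<le> 1"
  by (auto simp: clip_def)

lemma clip_id: "r \<in> {0..1} \<Longrightarrow> clip r = r"
  by (auto simp: clip_def)

lemma clip_measurable [measurable]: "clip \<in> borel_measurable borel"
  unfolding clip_def by measurable

context directed_game
begin

definition clipped_total :: "nat \<Rightarrow> 'a \<Rightarrow> 'w \<Rightarrow> real" where
  "clipped_total n z \<omega> = val (\<lambda>x. clip (G x \<omega>)) n True z"

abbreviation "mean_total n z \<equiv> expectation (clipped_total n z)"

lemma payoff_measurable: "x \<in> pverts \<Gamma> \<Longrightarrow> G x \<in> borel_measurable M"
  using payoffs_indep by (auto simp: indep_vars_def)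

lemma reachable_within_verts: "z \<in> pverts \<Gamma> \<Longrightarrow> reachable_within \<Gamma> n z \<subseteq> pverts \<Gamma>"
proof
  fix w assume z: "z \<in> pverts \<Gamma>" and "w \<in> reachable_within \<Gamma> n z"
  then obtain k where "(z, w) \<in> parcs \<Gamma> ^^ k" by (auto simp: reachable_within_def)
  then show "w \<in> pverts \<Gamma>" using z by (cases k) (auto dest: in_arcsD2)
qed

lemma self_reachable_within: "z \<in> reachable_within \<Gamma> n z"
  unfolding reachable_within_def by (auto intro: exI[of _ 0])

lemma clipped_total_measurable [measurable]:
  assumes "z \<in> pverts \<Gamma>"
  shows "clipped_total n z \<in> borel_measurable M"
  unfolding clipped_total_def
proof (rule total_measurable)
  fix x assume "x \<in> reachable_within \<Gamma> n z"
  then have [measurable]: "G x \<in> borel_measurable M"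
    using reachable_within_verts[OF assms] payoff_measurable by blast
  show "(\<lambda>\<omega>. clip (G x \<omega>)) \<in> borel_measurable M" by measurable
qed

lemma clipped_total_bounds:
  assumes "z \<in> pverts \<Gamma>"
  shows "0 \<le> clipped_total n z \<omega>" "clipped_total n z \<omega> \<le> real n"
proof -
  have "real n * 0 \<le> clipped_total n z \<omega> \<and> clipped_total n z \<omega> \<le> real n * 1"
    unfolding clipped_total_def using assms by (intro total_bounded clip_bounds(1,2))
  then show "0 \<le> clipped_total n z \<omega>" "clipped_total n z \<omega> \<le> real n" by simp_all
qed

lemma clipped_total_integrable:
  assumes "z \<in> pverts \<Gamma>"
  shows "integrable M (clipped_total n z)"
  using clipped_total_bounds[OF assms, of n]
  by (intro integrable_const_bound[where B = "real n"] clipped_total_measurable assms) auto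

lemma mean_total_bounds:
  assumes "z \<in> pverts \<Gamma>"
  shows "0 \<le> mean_total n z" "mean_total n z \<le> real n"
proof -
  show "0 \<le> mean_total n z"
    using clipped_total_bounds[OF assms] by (intro integral_nonneg_AE AE_I2) auto
  have "mean_total n z \<le> expectation (\<lambda>_. real n)"
    using clipped_total_bounds[OF assms] clipped_total_integrable[OF assms] by (intro integral_mono) auto
  then show "mean_total n z \<le> real n" by (simp add: prob_space)
qed

lemma total_restrict_measurable:
  "(\<lambda>x. val (\<lambda>v. clip (x v)) n True z) \<in> borel_measurable (Pi\<^sub>M (reachable_within \<Gamma> n z) (\<lambda>_. borel))"
proof (rule total_measurable)
  fix v assume [measurable]: "v \<in> reachable_within \<Gamma> n z"
  show "(\<lambda>x. clip (x v)) \<in> borel_measurable (Pi\<^sub>M (reachable_within \<Gamma> n z) (\<lambda>_. borel))"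
    by measurable
qed

text \<open>Puts the total value into the form of a fixed function of a finite family of payoffs, as
  the concentration and reindexing results require.\<close>

lemma clipped_total_restrict:
  "clipped_total n z \<omega> = val (\<lambda>v. clip ((\<lambda>i\<in>reachable_within \<Gamma> n z. G i \<omega>) v)) n True z"
  unfolding clipped_total_def by (intro total_cong) auto

section \<open>Concentration and invariance of the mean\<close>

lemma clipped_total_concentration:
  assumes z: "z \<in> pverts \<Gamma>" and Q: "adapted_partition \<Gamma> z Q"
    and cover: "reachable_within \<Gamma> n z \<subseteq> (\<Union>j\<le>k. Q j)" and "0 \<le> t"
  shows "prob {\<omega> \<in> space M. t \<le> \<bar>clipped_total n z \<omega> - mean_total n z\<bar>}
    \<le> 2 * exp (- (2 * t\<^sup>2 / (real k + 1)))"
proof -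
  let ?R = "reachable_within \<Gamma> n z"
  \<comment> \<open>Cutting the parts down to the reachable states makes the blocks finite. The
    parts 0 to \<open>k\<close> give \<open>k + 1\<close> blocks.\<close>
  define B where "B j = Q j \<inter> ?R" for j
  let ?f = "\<lambda>x. val (\<lambda>v. clip (x v)) n True z"
  have osc: "?f x \<le> ?f y + 1" if "\<And>i. i \<notin> B j \<Longrightarrow> x i = y i" for j x y
  proof (rule total_le_block[OF z, of "B j"])
    show "clip (x v) = clip (y v)" if "v \<notin> B j" for v using \<open>\<And>i. i \<notin> B j \<Longrightarrow> x i = y i\<close> that by simp
    show "clip (x v) \<le> clip (y v) + 1" for v using clip_bounds(2)[of "x v"] clip_bounds(1)[of "y v"] by linarith
    show "i = i'" if "\<sigma> \<in> strategies1 \<Gamma>" "\<tau> \<in> strategies2 \<Gamma>"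
      "trajectory \<sigma> \<tau> z i \<in> B j" "trajectory \<sigma> \<tau> z i' \<in> B j" for \<sigma> \<tau> i i'
      using adapted_partition_once[OF Q z that(1,2)] that(3,4) by (auto simp: B_def)
  qed
  have osc2: "\<bar>?f x - ?f y\<bar> \<le> 1" if "\<And>i. i \<notin> B j \<Longrightarrow> x i = y i" for j x y
    using osc[of j x y] osc[of j y x] that by fastforce
  have "prob {\<omega> \<in> space M. t \<le> \<bar>?f (\<lambda>i\<in>?R. G i \<omega>) - expectation (\<lambda>\<omega>. ?f (\<lambda>i\<in>?R. G i \<omega>))\<bar>}
      \<le> 2 * exp (- (2 * t\<^sup>2 / (real (Suc k) * 1\<^sup>2)))"
  proof (rule block_concentration[where f = ?f and B = B])
    show "indep_vars (\<lambda>_. borel) G ?R"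
      using payoffs_indep reachable_within_verts[OF z] by (rule indep_vars_subset)
    show "?R = (\<Union>j<Suc k. B j)" using cover by (auto simp: B_def lessThan_Suc_atMost)
    show "?R \<noteq> {}" using self_reachable_within by blast
    show "finite (B j)" for j using finite_reachable_within by (simp add: B_def)
    show "disjoint_family B"
      using Q unfolding adapted_partition_def B_def disjoint_family_on_def by blast
    show "?f \<in> borel_measurable (Pi\<^sub>M ?R (\<lambda>_. borel))" by (rule total_restrict_measurable)
    show "\<bar>?f x\<bar> \<le> real n" for x
      using total_bounded[of 0 "\<lambda>v. clip (x v)" 1, OF clip_bounds(1,2) z, of n True] by auto
    show "\<bar>?f x - ?f y\<bar> \<le> 1" if "j < Suc k" "\<And>i. i \<notin> B j \<Longrightarrow> x i = y i" for j x y
      using osc2 that(2) by blast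
  qed (use \<open>0 \<le> t\<close> in auto)
  then show ?thesis
    unfolding clipped_total_restrict[symmetric] by (simp add: add.commute)
qed

text \<open>The value at \<open>c\<close> is the same function of the payoffs
  \<open>G (\<phi> x)\<close> as the value at \<open>z\<close> is of the payoffs \<open>G x\<close>.
  The two values are different random variables, but \<phi> is injective and the payoffs are i.i.d.,
  so their means agree.\<close>

lemma mean_total_equivalent:
  assumes z: "z \<in> pverts \<Gamma>" and c: "c \<in> pverts \<Gamma>" and eq: "equivalent_states \<Gamma> z c"
  shows "mean_total n z = mean_total n c"
proof -
  obtain \<phi> where \<phi>: "bij_betw \<phi> (descendants \<Gamma> z) (descendants \<Gamma> c)" "\<phi> z = c"
    "\<And>u. u \<in> descendants \<Gamma> z \<Longrightarrow> parcs \<Gamma> `` {\<phi> u} = \<phi> ` (parcs \<Gamma> `` {u})"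
    using equivalent_states_bij[OF z c eq] by blast
  let ?R = "reachable_within \<Gamma> n z"
  let ?f = "\<lambda>x. val (\<lambda>v. clip (x v)) n True z"
  have R: "?R \<subseteq> descendants \<Gamma> z"
    using z by (auto simp: descendants_eq reachable_within_def relpow_imp_rtrancl)
  have D: "descendants \<Gamma> c \<subseteq> pverts \<Gamma>"
    unfolding descendants_def using reachable_in_verts by auto
  have "clipped_total n c \<omega> = val (\<lambda>x. clip (G (\<phi> x) \<omega>)) n True z" for \<omega>
    unfolding clipped_total_def \<phi>(2)[symmetric] using \<phi>(3)
    by (intro total_iso[where D = "descendants \<Gamma> z"])
       (use z in \<open>auto simp: descendants_eq intro: rtrancl_into_rtrancl\<close>)
  also have "\<dots> \<omega> = ?f (\<lambda>i\<in>?R. G (\<phi> i) \<omega>)" for \<omega>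
    by (intro total_cong) auto
  finally have "mean_total n c = expectation (\<lambda>\<omega>. ?f (\<lambda>i\<in>?R. G (\<phi> i) \<omega>))"
    by (rule Bochner_Integration.integral_cong[OF refl])
  also have "\<dots> = expectation (\<lambda>\<omega>. ?f (\<lambda>i\<in>?R. G i \<omega>))"
  proof (rule expectation_iid_reindex[OF payoffs_indep payoffs_identically_distributed])
    show "inj_on \<phi> ?R" using \<phi>(1) R by (auto simp: bij_betw_def intro: inj_on_subset)
    show "\<phi> \<in> ?R \<rightarrow> pverts \<Gamma>" using \<phi>(1) R D by (auto simp: bij_betw_def)
    show "?R \<noteq> {}" using self_reachable_within by blast
  qed (use reachable_within_verts[OF z] total_restrict_measurable in auto)
  also have "\<dots> = mean_total n z"
    unfolding clipped_total_restrict[symmetric] by simp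
  finally show ?thesis by simp
qed

text \<open>Ensures that the maximum of cardinalities in \<open>psi\<close> is taken over a finite
  set. The bound on the out-degrees makes it uniform in \<open>z\<close>.\<close>

lemma card_reachable_within_bounded: "\<exists>N. \<forall>z\<in>pverts \<Gamma>. card (reachable_within \<Gamma> n z) \<le> N"
proof -
  obtain D where D: "\<And>z. z \<in> pverts \<Gamma> \<Longrightarrow> out_degree \<Gamma> z \<le> D" using bounded_degrees by blast
  have succ: "card (parcs \<Gamma> `` {z}) \<le> D" if "z \<in> pverts \<Gamma>" for z
  proof -
    have "parcs \<Gamma> `` {z} = snd ` out_arcs \<Gamma> z" by (auto simp: out_arcs_def image_iff)
    then have "card (parcs \<Gamma> `` {z}) \<le> out_degree \<Gamma> z"
      using locally_finite[OF that] card_image_le by (auto simp: out_degree_def)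
    then show ?thesis using D[OF that] by simp
  qed
  have level: "finite ((parcs \<Gamma> ^^ k) `` {z}) \<and> card ((parcs \<Gamma> ^^ k) `` {z}) \<le> D ^ k" if "z \<in> pverts \<Gamma>" for k z
  proof (induction k)
    case (Suc k)
    let ?A = "(parcs \<Gamma> ^^ k) `` {z}"
    have A: "?A \<subseteq> pverts \<Gamma>"
      using reachable_within_verts[OF that, of k] by (auto simp: reachable_within_def)
    have eq: "(parcs \<Gamma> ^^ Suc k) `` {z} = (\<Union>w\<in>?A. parcs \<Gamma> `` {w})" by auto
    have "card (\<Union>w\<in>?A. parcs \<Gamma> `` {w}) \<le> (\<Sum>w\<in>?A. card (parcs \<Gamma> `` {w}))"
      using Suc by (intro card_UN_le) auto
    also have "\<dots> \<le> (\<Sum>w\<in>?A. D)" using A succ by (intro sum_mono) auto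
    also have "\<dots> \<le> D ^ Suc k" using Suc by simp
    finally show ?case unfolding eq using Suc succ_finite by auto
  qed simp
  have "card (reachable_within \<Gamma> n z) \<le> (\<Sum>k\<le>n. D ^ k)" if "z \<in> pverts \<Gamma>" for z
  proof -
    have "reachable_within \<Gamma> n z = (\<Union>k\<in>{..n}. (parcs \<Gamma> ^^ k) `` {z})"
      by (auto simp: reachable_within_def)
    then have "card (reachable_within \<Gamma> n z) \<le> (\<Sum>k\<le>n. card ((parcs \<Gamma> ^^ k) `` {z}))"
      using card_UN_le[of "{..n}" "\<lambda>k. (parcs \<Gamma> ^^ k) `` {z}"] by simp
    also have "\<dots> \<le> (\<Sum>k\<le>n. D ^ k)" using level[OF that] by (intro sum_mono) auto
    finally show ?thesis .
  qed
  then show ?thesis by blast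
qed

lemma card_reachable_within_le_Max:
  assumes "z \<in> pverts \<Gamma>"
  shows "card (reachable_within \<Gamma> n z) \<le> (MAX z\<in>pverts \<Gamma>. card (reachable_within \<Gamma> n z))"
proof (rule Max_ge)
  obtain N where "\<forall>z\<in>pverts \<Gamma>. card (reachable_within \<Gamma> n z) \<le> N"
    using card_reachable_within_bounded by blast
  then have "(\<lambda>z. card (reachable_within \<Gamma> n z)) ` pverts \<Gamma> \<subseteq> {..N}" by auto
  then show "finite ((\<lambda>z. card (reachable_within \<Gamma> n z)) ` pverts \<Gamma>)"
    by (rule finite_subset) simp
qed (use assms in auto)

text \<open>Every state reaches itself, so the cardinality factor of \<open>psi\<close> is at least
  1. Thus the rate assumed for \<open>psi\<close> passes to the bare exponential.\<close>

lemma exp_le_psi: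
  "exp (- (t\<^sup>2 * (real n)\<^sup>2 / (2 * real (transient_speed \<Gamma> P n)))) \<le> psi \<Gamma> P n t"
proof -
  have "1 \<le> card (reachable_within \<Gamma> (2 * n) z\<^sub>0)"
    using finite_reachable_within self_reachable_within by (simp add: Suc_le_eq card_gt_0_iff) blast
  also have "\<dots> \<le> (MAX z\<in>pverts \<Gamma>. card (reachable_within \<Gamma> (2 * n) z))"
    using initial_state by (rule card_reachable_within_le_Max)
  finally have "1 \<le> real (MAX z\<in>pverts \<Gamma>. card (reachable_within \<Gamma> (2 * n) z))" by simp
  then have "exp x * 1 \<le> exp x * real (MAX z\<in>pverts \<Gamma>. card (reachable_within \<Gamma> (2 * n) z))" for x
    by (intro mult_left_mono) auto
  then show ?thesis by (simp add: psi_def)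
qed

lemma transient_concentration:
  assumes P: "delta_adapted_family \<Gamma> \<delta> P" and z: "z \<in> pverts \<Gamma>" and "0 \<le> t"
  shows "prob {\<omega> \<in> space M. real n * t \<le> \<bar>clipped_total n z \<omega> - mean_total n z\<bar>}
    \<le> 2 * exp (- (t\<^sup>2 * (real n)\<^sup>2 / (2 * real (transient_speed \<Gamma> P n))))"
proof (cases "transient_speed \<Gamma> P n = 0")
  \<comment> \<open>The exponent is then a quotient by zero, hence 0, and the bound is the trivial
    2.\<close>
  case True
  then show ?thesis
    by (auto intro: order_trans[OF prob_le_1])
next
  case False
  let ?k = "partition_depth \<Gamma> P n z" and ?h = "transient_speed \<Gamma> P n"
  have Q: "adapted_partition \<Gamma> z (P z)" using P z by (auto simp: delta_adapted_family_def)
  \<comment> \<open>Finitely many reachable states lie in finitely many parts, so the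
    \<open>LEAST\<close> in \<open>partition_depth\<close> is attained.\<close>
  have "\<exists>k. reachable_within \<Gamma> n z \<subseteq> (\<Union>j\<le>k. P z j)"
  proof -
    have "(\<Union>j. P z j) = pverts \<Gamma>" using Q by (simp add: adapted_partition_def)
    then have "\<exists>j. w \<in> P z j" if "w \<in> reachable_within \<Gamma> n z" for w
      using that reachable_within_verts[OF z, of n] by blast
    then obtain J where J: "\<And>w. w \<in> reachable_within \<Gamma> n z \<Longrightarrow> w \<in> P z (J w)" by metis
    have "J w \<le> Max (J ` reachable_within \<Gamma> n z)" if "w \<in> reachable_within \<Gamma> n z" for w
      using that finite_reachable_within by (intro Max_ge) auto
    then show ?thesis using J by (intro exI[of _ "Max (J ` reachable_within \<Gamma> n z)"]) blast
  qed
  then have cover: "reachable_within \<Gamma> n z \<subseteq> (\<Union>j\<le>?k. P z j)"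
    unfolding partition_depth_def by (rule LeastI_ex)
  have "finite (partition_depth \<Gamma> P n ` pverts \<Gamma>)" using P by (auto simp: delta_adapted_family_def)
  then have "?k \<le> ?h" unfolding transient_speed_def using z by (intro Max_ge) auto
  \<comment> \<open>The part \<open>{z}\<close> counts as a block too; the constant \<open>1 / 2\<close> instead of \<open>2\<close> absorbs it.\<close>
  then have k: "real ?k + 1 \<le> 4 * real ?h" using False by linarith
  have "t\<^sup>2 * (real n)\<^sup>2 / (2 * real ?h) = 2 * (real n * t)\<^sup>2 / (4 * real ?h)"
    by (simp add: power_mult_distrib)
  also have "\<dots> \<le> 2 * (real n * t)\<^sup>2 / (real ?k + 1)"
    using k by (intro divide_left_mono) (auto simp: False)
  finally have "exp (- (2 * (real n * t)\<^sup>2 / (real ?k + 1))) \<le> exp (- (t\<^sup>2 * (real n)\<^sup>2 / (2 * real ?h)))"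
    by simp
  then have "2 * exp (- (2 * (real n * t)\<^sup>2 / (real ?k + 1))) \<le> 2 * exp (- (t\<^sup>2 * (real n)\<^sup>2 / (2 * real ?h)))"
    by (rule mult_left_mono) simp
  moreover have "0 \<le> real n * t" using \<open>0 \<le> t\<close> by simp
  ultimately show ?thesis
    using order_trans[OF clipped_total_concentration[OF z Q cover]] by blast
qed

section \<open>Almost additivity of the mean and the limit value\<close>

text \<open>Outside the event \<open>bad\<close>, on which some reachable state equivalent to
  \<open>c\<close> has an \<open>m\<close>-stage value far from the mean, the deterministic
  comparison holds with \<open>d = m * \<epsilon>\<close>. On \<open>bad\<close> the trivial bound
  \<open>2 * m\<close> is used, and \<open>prob bad \<le> 2 * psi\<close> yields the last term
  \<open>4 * m * psi\<close>. The assumption \<open>len\<close> keeps all states to be controlled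
  within the \<open>2 * m\<close> steps counted by \<open>psi\<close>.\<close>

lemma mean_total_concat:
  assumes P: "delta_adapted_family \<Gamma> \<delta> P" and z: "z \<in> pverts \<Gamma>" and c: "c \<in> pverts \<Gamma>"
    and force: "\<And>w. w \<in> pverts \<Gamma> \<Longrightarrow>
     (\<exists>\<sigma>\<in>strategies1 \<Gamma>. \<forall>\<tau>\<in>strategies2 \<Gamma>. \<exists>l\<le>L. even l \<and> equivalent_states \<Gamma> (trajectory \<sigma> \<tau> w l) c) \<and>
     (\<exists>\<tau>\<in>strategies2 \<Gamma>. \<forall>\<sigma>\<in>strategies1 \<Gamma>. \<exists>l\<le>L. even l \<and> equivalent_states \<Gamma> (trajectory \<sigma> \<tau> w l) c)"
    and len: "n + 1 + L \<le> 2 * m" and "0 < \<epsilon>"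
  shows "\<bar>mean_total (n + m) z - mean_total n z - mean_total m c\<bar>
    \<le> real m * \<epsilon> + 2 * real L + 2 + 4 * real m * psi \<Gamma> P m \<epsilon>"
proof -
  let ?W = "{w \<in> reachable_within \<Gamma> (2 * m) z. equivalent_states \<Gamma> w c}"
  let ?A = "\<lambda>w. {\<omega> \<in> space M. real m * \<epsilon> \<le> \<bar>clipped_total m w \<omega> - mean_total m w\<bar>}"
  define bad where "bad = (\<Union>w\<in>?W. ?A w)"
  have W: "finite ?W" "?W \<subseteq> pverts \<Gamma>"
    using finite_reachable_within[of "2 * m" z] reachable_within_verts[OF z] by auto
  have A: "?A w \<in> sets M" if "w \<in> ?W" for w
  proof -
    have [measurable]: "clipped_total m w \<in> borel_measurable M"
      using that W(2) by (intro clipped_total_measurable) auto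
    show ?thesis by measurable
  qed
  have bad [measurable]: "bad \<in> sets M" unfolding bad_def using W(1) A by (intro sets.finite_UN) auto
  let ?e = "exp (- (\<epsilon>\<^sup>2 * (real m)\<^sup>2 / (2 * real (transient_speed \<Gamma> P m))))"
  have "prob bad \<le> (\<Sum>w\<in>?W. prob (?A w))"
    unfolding bad_def using W(1) A by (intro measure_UNION_le) auto
  also have "\<dots> \<le> (\<Sum>w\<in>?W. 2 * ?e)"
    using W(2) \<open>0 < \<epsilon>\<close> by (intro sum_mono transient_concentration[OF P]) auto
  also have "\<dots> = 2 * ?e * real (card ?W)" by simp
  also have "\<dots> \<le> 2 * ?e * real (MAX z\<in>pverts \<Gamma>. card (reachable_within \<Gamma> (2 * m) z))"
  proof (intro mult_left_mono of_nat_mono)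
    have "card ?W \<le> card (reachable_within \<Gamma> (2 * m) z)"
      by (intro card_mono finite_reachable_within) auto
    also note card_reachable_within_le_Max[OF z]
    finally show "card ?W \<le> (MAX z\<in>pverts \<Gamma>. card (reachable_within \<Gamma> (2 * m) z))" .
  qed simp
  finally have prob_bad: "prob bad \<le> 2 * psi \<Gamma> P m \<epsilon>" by (simp add: psi_def)
  define D where "D \<omega> = clipped_total (n + m) z \<omega> - clipped_total n z \<omega> - mean_total m c" for \<omega>
  let ?a = "real m * \<epsilon> + 2 * real L + 2"
  have g: "\<forall>x. \<bar>clip (G x \<omega>)\<bar> \<le> 1" for \<omega> using clip_bounds(3) by blast
  have D_good: "\<bar>D \<omega>\<bar> \<le> ?a" if "\<omega> \<in> space M" "\<omega> \<notin> bad" for \<omega>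
    unfolding D_def clipped_total_def[where \<omega> = \<omega>]
  proof (rule weakly_transitive_concat[where T = "\<lambda>w. equivalent_states \<Gamma> w c", OF g z force])
    fix w assume w: "w \<in> reachable_within \<Gamma> (n + 1 + L) z" "equivalent_states \<Gamma> w c"
    have "w \<in> ?W"
    proof -
      have "reachable_within \<Gamma> (n + 1 + L) z \<subseteq> reachable_within \<Gamma> (2 * m) z"
        unfolding reachable_within_def using len by (auto intro: order_trans)
      then show ?thesis using w by blast
    qed
    then have "\<bar>clipped_total m w \<omega> - mean_total m w\<bar> \<le> real m * \<epsilon>"
      using that unfolding bad_def by force
    moreover have "mean_total m w = mean_total m c"
      using \<open>w \<in> ?W\<close> W(2) w(2) c by (intro mean_total_equivalent) auto
    ultimately show "\<bar>val (\<lambda>x. clip (G x \<omega>)) m True w - mean_total m c\<bar> \<le> real m * \<epsilon>"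
      by (simp add: clipped_total_def)
  qed
  \<comment> \<open>Adding \<open>m\<close> stages moves the total by at most \<open>m\<close>, and
    the mean at \<open>c\<close> lies between 0 and \<open>m\<close>.\<close>
  have D_all: "\<bar>D \<omega>\<bar> \<le> 2 * real m" for \<omega>
    using total_lipschitz[OF g[of \<omega>] z, of n m True] mean_total_bounds[OF c, of m]
    by (auto simp: D_def clipped_total_def)
  have D_int: "integrable M D" unfolding D_def using clipped_total_integrable[OF z] by auto
  have "mean_total (n + m) z - mean_total n z - mean_total m c = expectation D"
    unfolding D_def using clipped_total_integrable[OF z] by (simp add: prob_space)
  also have "\<bar>\<dots>\<bar> \<le> expectation (\<lambda>\<omega>. \<bar>D \<omega>\<bar>)" by (rule integral_abs_bound)
  also have "\<dots> \<le> expectation (\<lambda>\<omega>. ?a + 2 * real m * indicator bad \<omega>)"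
  proof (intro integral_mono)
    show "integrable M (\<lambda>\<omega>. \<bar>D \<omega>\<bar>)" using D_int by simp
    show "integrable M (\<lambda>\<omega>. ?a + 2 * real m * indicator bad \<omega>)"
      using bad by (auto intro!: integrable_real_indicator simp: less_top[symmetric])
    have "0 \<le> ?a" using \<open>0 < \<epsilon>\<close> by simp
    then show "\<bar>D \<omega>\<bar> \<le> ?a + 2 * real m * indicator bad \<omega>" if "\<omega> \<in> space M" for \<omega>
      using D_good[OF that] D_all[of \<omega>] by (cases "\<omega> \<in> bad") auto
  qed
  also have "\<dots> = ?a + 2 * real m * prob bad"
    using bad by (subst Bochner_Integration.integral_add) (auto simp: prob_space less_top[symmetric])
  also have "\<dots> \<le> ?a + 2 * real m * (2 * psi \<Gamma> P m \<epsilon>)"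
    using prob_bad by (intro add_left_mono mult_left_mono) auto
  finally show ?thesis by simp
qed

text \<open>The increment is compared with \<open>c\<close> whatever the initial state
  \<open>z\<close>. So \<open>z = c\<close> yields an almost additive sequence, and
  \<open>n = 0\<close> shows that the mean hardly depends on \<open>z\<close>.\<close>

lemma mean_total_almost_additive:
  assumes "0 < \<delta>" "\<delta> < 1" and P: "delta_adapted_family \<Gamma> \<delta> P" and "weakly_transitive \<Gamma>"
  shows "\<exists>c\<in>pverts \<Gamma>. \<exists>C. \<forall>m\<ge>1. \<forall>n\<le>m. \<forall>z\<in>pverts \<Gamma>.
    \<bar>mean_total (n + m) z - mean_total n z - mean_total m c\<bar> \<le> C * real m powr (1 - \<delta>)"
proof -
  obtain c L where c: "c \<in> pverts \<Gamma>" and force: "\<And>w. w \<in> pverts \<Gamma> \<Longrightarrow>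
     (\<exists>\<sigma>\<in>strategies1 \<Gamma>. \<forall>\<tau>\<in>strategies2 \<Gamma>. \<exists>l\<le>L. even l \<and> equivalent_states \<Gamma> (trajectory \<sigma> \<tau> w l) c) \<and>
     (\<exists>\<tau>\<in>strategies2 \<Gamma>. \<forall>\<sigma>\<in>strategies1 \<Gamma>. \<exists>l\<le>L. even l \<and> equivalent_states \<Gamma> (trajectory \<sigma> \<tau> w l) c)"
    using assms(4) unfolding weakly_transitive_def by metis
  obtain \<epsilon> where \<epsilon>: "\<And>n. 1 \<le> n \<Longrightarrow> 0 < \<epsilon> n"
    "(\<lambda>n. \<epsilon> n + psi \<Gamma> P n (\<epsilon> n)) \<in> O(\<lambda>n. real n powr (-\<delta>))"
    using P unfolding delta_adapted_family_def by blast
  have "\<exists>C>0. \<exists>N. \<forall>n\<ge>N. \<epsilon> n \<le> C * real n powr (-\<delta>) \<and> psi \<Gamma> P n (\<epsilon> n) \<le> C * real n powr (-\<delta>)"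
    by (rule bigo_sum_bounds) (use \<epsilon> in \<open>auto simp: psi_def\<close>)
  then obtain C N where C: "C > 0" and N: "\<And>n. n \<ge> N \<Longrightarrow> \<epsilon> n \<le> C * real n powr (-\<delta>)"
    "\<And>n. n \<ge> N \<Longrightarrow> psi \<Gamma> P n (\<epsilon> n) \<le> C * real n powr (-\<delta>)"
    by blast
  \<comment> \<open>From \<open>m \<ge> L + 1\<close> and \<open>n \<le> m\<close> follows
    \<open>n + 1 + L \<le> 2 * m\<close>. In \<open>C1\<close>, the term \<open>5 * C\<close>
    collects \<open>C\<close> from \<open>m * \<epsilon> m\<close> and \<open>4 * C\<close> from the
    bad event, \<open>2 * L + 2\<close> comes from the steering, and \<open>2 * N1\<close> covers
    the small \<open>m\<close> by the trivial bound \<open>2 * m\<close>. The constants are absorbed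
    by \<open>m powr (1 - \<delta>) \<ge> 1\<close>.\<close>
  define N1 where "N1 = max N (L + 1)"
  define C1 where "C1 = 5 * C + 2 * real L + 2 + 2 * real N1"
  have "\<bar>mean_total (n + m) z - mean_total n z - mean_total m c\<bar> \<le> C1 * real m powr (1 - \<delta>)"
    if m: "1 \<le> m" "n \<le> m" and z: "z \<in> pverts \<Gamma>" for n m z
  proof -
    let ?D = "\<bar>mean_total (n + m) z - mean_total n z - mean_total m c\<bar>"
    let ?p = "real m powr (1 - \<delta>)"
    have p: "1 \<le> ?p" using m(1) \<open>\<delta> < 1\<close> by (intro ge_one_powr_ge_zero) auto
    have mp: "real m * (x * real m powr (-\<delta>)) = x * ?p" for x
      using m(1) by (simp add: powr_diff powr_minus divide_inverse)
    show ?thesis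
    proof (cases "m \<ge> N1")
      case True
      then have mN: "m \<ge> N" and "n + 1 + L \<le> 2 * m" using m(2) by (auto simp: N1_def)
      then have "?D \<le> real m * \<epsilon> m + 2 * real L + 2 + 4 * real m * psi \<Gamma> P m (\<epsilon> m)"
        using mean_total_concat[OF P z c force] \<epsilon>(1)[OF m(1)] by blast
      also have "\<dots> \<le> real m * (C * real m powr (-\<delta>)) + 2 * real L + 2 + 4 * (real m * (C * real m powr (-\<delta>)))"
        using N[OF mN] by (intro add_mono order_refl mult_left_mono) (auto simp: mult.assoc intro!: mult_left_mono)
      also have "\<dots> = 5 * C * ?p + (2 * real L + 2) * 1" unfolding mp by simp
      also have "\<dots> \<le> 5 * C * ?p + (2 * real L + 2 + 2 * real N1) * ?p"
        using p by (intro add_left_mono mult_mono) auto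
      finally show ?thesis by (simp add: C1_def algebra_simps)
    next
      case False
      have "clipped_total (n + m) z \<omega> \<le> clipped_total n z \<omega> + real m \<and>
          clipped_total n z \<omega> \<le> clipped_total (n + m) z \<omega> + real m" for \<omega>
        using total_lipschitz[of "\<lambda>x. clip (G x \<omega>)" z n m True] z clip_bounds(3)
        by (auto simp: clipped_total_def abs_le_iff)
      then have "mean_total (n + m) z \<le> expectation (\<lambda>\<omega>. clipped_total n z \<omega> + real m)"
        "mean_total n z \<le> expectation (\<lambda>\<omega>. clipped_total (n + m) z \<omega> + real m)"
        using clipped_total_integrable[OF z] by (intro integral_mono; simp)+
      then have "?D \<le> 2 * real m"
        using clipped_total_integrable[OF z] mean_total_bounds[OF c, of m] by (simp add: prob_space)
      also have "\<dots> \<le> (2 * real N1) * 1" using False by simp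
      also have "\<dots> \<le> (5 * C + 2 * real L + 2 + 2 * real N1) * ?p"
        using p C by (intro mult_mono) auto
      finally show ?thesis by (simp add: C1_def)
    qed
  qed
  then show ?thesis using c by blast
qed

lemma mean_total_rate:
  assumes "0 < \<delta>" "\<delta> < 1" and P: "delta_adapted_family \<Gamma> \<delta> P" and "weakly_transitive \<Gamma>"
  shows "\<exists>v\<in>{0..1}. \<exists>K>0. \<forall>n\<ge>1. \<forall>z\<in>pverts \<Gamma>. \<bar>mean_total n z / real n - v\<bar> \<le> K * real n powr (-\<delta>)"
proof -
  obtain c C where c: "c \<in> pverts \<Gamma>" and C: "\<And>m n z. 1 \<le> m \<Longrightarrow> n \<le> m \<Longrightarrow> z \<in> pverts \<Gamma> \<Longrightarrow>
    \<bar>mean_total (n + m) z - mean_total n z - mean_total m c\<bar> \<le> C * real m powr (1 - \<delta>)"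
    using mean_total_almost_additive[OF assms] by blast
  obtain v K where vK: "\<And>n. n \<ge> 1 \<Longrightarrow> \<bar>mean_total n c - real n * v\<bar> \<le> K * real n powr (1 - \<delta>)"
    using almost_additive_imp_almost_linear[of "\<lambda>n. mean_total n c" C \<delta>] C c \<open>0 < \<delta>\<close> by blast
  \<comment> \<open>The absolute values make it dominate \<open>C + K\<close> whatever the signs,
    and the summand 1 makes it positive.\<close>
  define K' where "K' = \<bar>C\<bar> + \<bar>K\<bar> + 1"
  have rate: "\<bar>mean_total n z / real n - v\<bar> \<le> K' * real n powr (-\<delta>)" if n: "n \<ge> 1" and z: "z \<in> pverts \<Gamma>" for n z
  proof -
    \<comment> \<open>The case \<open>n = 0\<close> of almost additivity carries the rate from
      \<open>c\<close> over to \<open>z\<close>.\<close>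
    have "mean_total 0 z = 0" using mean_total_bounds[OF z, of 0] by simp
    then have "\<bar>mean_total n z - mean_total n c\<bar> \<le> C * real n powr (1 - \<delta>)"
      using C[of n 0 z] n z by simp
    then have "\<bar>mean_total n z - real n * v\<bar> \<le> C * real n powr (1 - \<delta>) + K * real n powr (1 - \<delta>)"
      using vK[OF n] by linarith
    also have "\<dots> = (C + K) * real n powr (1 - \<delta>)" by (simp add: algebra_simps)
    also have "\<dots> \<le> K' * real n powr (1 - \<delta>)" by (intro mult_right_mono) (auto simp: K'_def)
    also have "\<dots> = real n * (K' * real n powr (-\<delta>))"
      using n by (simp add: powr_diff powr_minus divide_inverse)
    finally have "\<bar>mean_total n z - real n * v\<bar> / real n \<le> K' * real n powr (-\<delta>)"
      using n by (simp add: pos_divide_le_eq mult.commute)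
    moreover have "mean_total n z / real n - v = (mean_total n z - real n * v) / real n"
      using n by (simp add: diff_divide_distrib)
    ultimately show ?thesis by (simp add: abs_divide)
  qed
  have "(\<lambda>n. mean_total n c / real n - v) \<longlonglongrightarrow> 0"
    by (rule Lim_null_comparison[OF _ powr_decay[OF \<open>0 < \<delta>\<close>]]) (use rate c in \<open>auto simp: eventually_sequentially intro!: exI[of _ 1]\<close>)
  then have lim: "(\<lambda>n. mean_total n c / real n) \<longlonglongrightarrow> v" by (rule LIM_zero_cancel)
  have "0 \<le> mean_total n c / real n \<and> mean_total n c / real n \<le> 1" for n
    using mean_total_bounds[OF c, of n] by (cases "n = 0") auto
  then have "v \<in> {0..1}"
    using LIMSEQ_le_const[OF lim, of 0] LIMSEQ_le_const2[OF lim, of 1] by auto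
  moreover have "K' > 0" by (simp add: K'_def)
  ultimately show ?thesis using rate by blast
qed

section \<open>Almost sure statements\<close>

text \<open>There are countably many states, so a single null set serves all of them and all
  \<open>n\<close>.\<close>

lemma AE_game_value_eq:
  assumes "\<And>z. z \<in> pverts \<Gamma> \<Longrightarrow> AE \<omega> in M. G z \<omega> \<in> {0..1}"
  shows "AE \<omega> in M. \<forall>z\<in>pverts \<Gamma>. \<forall>n. game_value \<Gamma> (\<lambda>x. G x \<omega>) n z = clipped_total n z \<omega> / real n"
proof -
  have "AE \<omega> in M. \<forall>x\<in>pverts \<Gamma>. G x \<omega> \<in> {0..1}"
    using assms countable_states by (simp add: AE_ball_countable)
  then show ?thesis
  proof eventually_elim
    case (elim \<omega>)
    have "val (\<lambda>x. G x \<omega>) n True z = clipped_total n z \<omega>" if "z \<in> pverts \<Gamma>" for n z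
      unfolding clipped_total_def
    proof (rule total_cong)
      fix x assume "x \<in> reachable_within \<Gamma> n z"
      then have "G x \<omega> \<in> {0..1}" using reachable_within_verts[OF that] elim by blast
      then show "G x \<omega> = clip (G x \<omega>)" by (simp add: clip_id)
    qed
    then show ?case by (simp add: game_value_eq_total)
  qed
qed

text \<open>Borel-Cantelli applied to the deviations of size \<open>t = 1 / (j + 1)\<close> for
  every \<open>j\<close>. Their probabilities are summable by \<open>summable_exp_rate\<close>,
  although the rate known at \<open>\<epsilon> n\<close> need not be.\<close>

lemma AE_clipped_total_tendsto:
  assumes "0 < \<delta>" and P: "delta_adapted_family \<Gamma> \<delta> P" and z: "z \<in> pverts \<Gamma>"
  shows "AE \<omega> in M. (\<lambda>n. (clipped_total n z \<omega> - mean_total n z) / real n) \<longlonglongrightarrow> 0"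
proof -
  define X where "X n = (real n)\<^sup>2 / (2 * real (transient_speed \<Gamma> P n))" for n
  obtain \<epsilon> where \<epsilon>: "\<And>n. 1 \<le> n \<Longrightarrow> 0 < \<epsilon> n"
    "(\<lambda>n. \<epsilon> n + psi \<Gamma> P n (\<epsilon> n)) \<in> O(\<lambda>n. real n powr (-\<delta>))"
    using P unfolding delta_adapted_family_def by blast
  have "(\<lambda>n. \<epsilon> n + exp (- ((\<epsilon> n)\<^sup>2 * X n))) \<in> O(\<lambda>n. \<epsilon> n + psi \<Gamma> P n (\<epsilon> n))"
  proof (intro landau_o.big_mono eventually_sequentiallyI)
    fix n :: nat assume "1 \<le> n"
    then show "norm (\<epsilon> n + exp (- ((\<epsilon> n)\<^sup>2 * X n))) \<le> norm (\<epsilon> n + psi \<Gamma> P n (\<epsilon> n))"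
      using \<epsilon>(1)[of n] exp_le_psi[of "\<epsilon> n" n P] by (simp add: X_def)
  qed
  then have O: "(\<lambda>n. \<epsilon> n + exp (- ((\<epsilon> n)\<^sup>2 * X n))) \<in> O(\<lambda>n. real n powr (-\<delta>))"
    using \<epsilon>(2) by (rule landau_o.big_trans)
  define A where "A t n = {\<omega> \<in> space M. real n * t \<le> \<bar>clipped_total n z \<omega> - mean_total n z\<bar>}" for t n
  note [measurable] = clipped_total_measurable[OF z]
  have "AE \<omega> in M. eventually (\<lambda>n. \<omega> \<in> space M - A t n) sequentially" if "0 < t" for t
  proof (rule borel_cantelli_AE1)
    show "A t n \<in> sets M" for n unfolding A_def by measurable
    show "emeasure M (A t n) < \<infinity>" for n by (simp add: less_top[symmetric])
    have "summable (\<lambda>n. exp (- (t\<^sup>2 * X n)))"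
      by (rule summable_exp_rate[OF _ \<open>0 < \<delta>\<close> that \<epsilon>(1) O]) (auto simp: X_def)
    then have "summable (\<lambda>n. 2 * exp (- (t\<^sup>2 * X n)))" by (rule summable_mult)
    moreover have "norm (prob (A t n)) \<le> 2 * exp (- (t\<^sup>2 * X n))" for n
      using transient_concentration[OF P z, of t n] that by (simp add: A_def X_def)
    ultimately show "summable (\<lambda>n. prob (A t n))" by (rule summable_comparison_test')
  qed
  then have "AE \<omega> in M. \<forall>j. eventually (\<lambda>n. \<omega> \<in> space M - A (inverse (real (Suc j))) n) sequentially"
    unfolding AE_all_countable by simp
  then show ?thesis
  proof eventually_elim
    case (elim \<omega>)
    show ?case
    proof (rule tendstoI)
      fix r :: real assume "0 < r"
      then obtain j where j: "inverse (real (Suc j)) < r" using reals_Archimedean by blast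
      from elim have "eventually (\<lambda>n. \<omega> \<in> space M - A (inverse (real (Suc j))) n) sequentially" by blast
      then show "eventually (\<lambda>n. dist ((clipped_total n z \<omega> - mean_total n z) / real n) 0 < r) sequentially"
        using eventually_gt_at_top[of 0]
      proof eventually_elim
        case (elim n)
        then have "\<bar>clipped_total n z \<omega> - mean_total n z\<bar> < real n * inverse (real (Suc j))"
          by (auto simp: A_def)
        also have "\<dots> < real n * r" using j elim by (intro mult_strict_left_mono) auto
        finally show ?case using elim by (simp add: abs_divide pos_divide_less_eq mult.commute)
      qed
    qed
  qed
qed

end

theorem theorem1:
  fixes M :: "'w measure" and \<Gamma> :: "'a pair_pre_digraph" and z\<^sub>0 :: 'a
    and G :: "'a \<Rightarrow> 'w \<Rightarrow> real" and \<delta> :: real and P :: "'a \<Rightarrow> nat \<Rightarrow> 'a set"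
  assumes "0 < \<delta>" and "\<delta> < 1 / 2"
    and "directed_game M \<Gamma> z\<^sub>0 G"
    and "weakly_transitive \<Gamma>"
    and "delta_transient \<Gamma> \<delta>"
    and "delta_adapted_family \<Gamma> \<delta> P"
    and "\<And>z. z \<in> pverts \<Gamma> \<Longrightarrow> AE \<omega> in M. G z \<omega> \<in> {0..1}"
  shows "\<exists>v\<in>{0..1::real}. \<exists>K>0.
    (\<forall>n\<ge>1. \<forall>t\<ge>0. \<forall>z\<in>pverts \<Gamma>.
       measure M {\<omega> \<in> space M.
           \<bar>game_value \<Gamma> (\<lambda>x. G x \<omega>) n z - v\<bar> \<ge> t + K * real n powr (-\<delta>)}
         \<le> 2 * exp (- (t\<^sup>2 * (real n)\<^sup>2 / (2 * real (transient_speed \<Gamma> P n))))) \<and>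
    (\<forall>z\<in>pverts \<Gamma>. AE \<omega> in M. (\<lambda>n. game_value \<Gamma> (\<lambda>x. G x \<omega>) n z) \<longlonglongrightarrow> v)"
proof -
  interpret directed_game M \<Gamma> z\<^sub>0 G by fact
  note P = assms(6)
  have "\<delta> < 1" using assms(2) by simp
  then obtain v K where v: "v \<in> {0..1}" and "K > 0" and rate: "\<And>n z. n \<ge> 1 \<Longrightarrow> z \<in> pverts \<Gamma> \<Longrightarrow>
      \<bar>mean_total n z / real n - v\<bar> \<le> K * real n powr (-\<delta>)"
    using mean_total_rate[OF assms(1) _ P assms(4)] by blast
  have eq: "AE \<omega> in M. \<forall>z\<in>pverts \<Gamma>. \<forall>n.
      game_value \<Gamma> (\<lambda>x. G x \<omega>) n z = clipped_total n z \<omega> / real n"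
    by (rule AE_game_value_eq) (rule assms(7))
  show ?thesis
  proof (intro bexI[OF _ v] exI[of _ K] conjI allI ballI impI)
    show "K > 0" by fact
    fix z assume z: "z \<in> pverts \<Gamma>"
    note [measurable] = clipped_total_measurable[OF z]
    {
      fix n :: nat and t :: real assume n: "1 \<le> n" and t: "0 \<le> t"
      let ?B = "{\<omega> \<in> space M. real n * t \<le> \<bar>clipped_total n z \<omega> - mean_total n z\<bar>}"
      have "measure M {\<omega> \<in> space M. \<bar>game_value \<Gamma> (\<lambda>x. G x \<omega>) n z - v\<bar> \<ge> t + K * real n powr (-\<delta>)}
          \<le> prob ?B"
      \<comment> \<open>Value and clipped value agree only almost surely, so the inclusion of events
        is almost sure too. Measurability is required of the larger event \<open>?B\<close>
        alone.\<close>
      proof (rule finite_measure_mono_AE)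
        show "AE \<omega> in M. \<omega> \<in> {\<omega> \<in> space M. \<bar>game_value \<Gamma> (\<lambda>x. G x \<omega>) n z - v\<bar> \<ge> t + K * real n powr (-\<delta>)}
            \<longrightarrow> \<omega> \<in> ?B"
          using eq
        proof eventually_elim
          case (elim \<omega>)
          then have e: "game_value \<Gamma> (\<lambda>x. G x \<omega>) n z = clipped_total n z \<omega> / real n" using z by blast
          have "real n * t \<le> \<bar>clipped_total n z \<omega> - mean_total n z\<bar>"
            if "\<bar>clipped_total n z \<omega> / real n - v\<bar> \<ge> t + K * real n powr (-\<delta>)"
          proof -
            \<comment> \<open>The summand \<open>K * n powr (-\<delta>)\<close> pays for the
              distance between \<open>v\<close> and the mean, which leaves \<open>t\<close> for the
              deviation from the mean.\<close>
            have "t \<le> \<bar>clipped_total n z \<omega> / real n - mean_total n z / real n\<bar>"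
              using that rate[OF n z] by linarith
            also have "\<dots> = \<bar>clipped_total n z \<omega> - mean_total n z\<bar> / real n"
              using n by (simp add: diff_divide_distrib[symmetric])
            finally show ?thesis using n by (simp add: pos_le_divide_eq mult.commute)
          qed
          then show ?case unfolding mem_Collect_eq e by blast
        qed
        show "?B \<in> events" by measurable
      qed
      also have "\<dots> \<le> 2 * exp (- (t\<^sup>2 * (real n)\<^sup>2 / (2 * real (transient_speed \<Gamma> P n))))"
        using transient_concentration[OF P z t] .
      finally show "measure M {\<omega> \<in> space M. \<bar>game_value \<Gamma> (\<lambda>x. G x \<omega>) n z - v\<bar> \<ge> t + K * real n powr (-\<delta>)}
         \<le> 2 * exp (- (t\<^sup>2 * (real n)\<^sup>2 / (2 * real (transient_speed \<Gamma> P n))))" .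
    }
    have "(\<lambda>n. mean_total n z / real n - v) \<longlonglongrightarrow> 0"
      by (rule Lim_null_comparison[OF _ powr_decay[OF \<open>0 < \<delta>\<close>]]) (use rate z in \<open>auto simp: eventually_sequentially intro!: exI[of _ 1]\<close>)
    then have mean: "(\<lambda>n. mean_total n z / real n) \<longlonglongrightarrow> v" by (rule LIM_zero_cancel)
    from AE_clipped_total_tendsto[OF assms(1) P z] eq
    show "AE \<omega> in M. (\<lambda>n. game_value \<Gamma> (\<lambda>x. G x \<omega>) n z) \<longlonglongrightarrow> v"
    proof eventually_elim
      case (elim \<omega>)
      from tendsto_add[OF elim(1) mean] have "(\<lambda>n. clipped_total n z \<omega> / real n) \<longlonglongrightarrow> v"
        by (simp add: diff_divide_distrib)
      then show ?case using elim(2) z by simp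
    qed
  qed
qed

end
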